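(* Let $\mathcal{A}$ be a finite set and let $d$ be in $\mathbb{N}$. For each $\alpha \in [0,1]$ and $\epsilon>0$, there exist $\rho>0$ and $n_0$ such that if $n \geq n_0$, then $$\mathbb{P}_{n,\alpha}\Bigl( \bigl| h_{\mathrm{per}}(X_\omega) - \log^+(\alpha|\mathcal{A}|) \bigr| \geq \epsilon \Bigr) \leq \exp(-\rho n^d).$$
   Context: Here $d\ge 1$. Let $F_n = [1,n]^d \subset \mathbb{Z}^d$ (integer points). Let $\Omega_n$ be the power set of $\mathcal{A}^{F_n}$. For $n\ge 1$ and $\alpha\in[0,1]$, $\mathbb{P}_{n,\alpha}$ is the probability measure on $\Omega_n$ under which the random subset $\omega \subset \mathcal{A}^{F_n}$ includes each element of $\mathcal{A}^{F_n}$ independently with probability $\alpha$. For $\omega \subset \mathcal{A}^{F_n}$, $X_\omega$ is the $\mathbb{Z}^d$-shift of finite type $$X_\omega = \{x \in \mathcal{A}^{\mathbb{Z}^d} : \forall p \in \mathbb{Z}^d,\ x|_{F_n+p} \in \omega\},$$ where patterns are identified up to translation. The shift action is $(\sigma^p(x))_q = x_{p+q}$ for $p,q\in\mathbb{Z}^d$. A finite orbit in a $\mathbb{Z}^d$-shift of finite type $X$ is a nonempty finite set $\gamma\subset X$ such that $\{\sigma^p(x):p\in\mathbb{Z}^d\}=\gamma$ for each $x\in\gamma$. Let $\mathcal{P}$ be the set of points $x\in X$ such that $x$ is contained in a finite orbit. The periodic entropy of $X$ is $$h_{\mathrm{per}}(X) = \limsup_{k\to\infty} \frac{1}{k^d}\log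 \bigl|\{x|_{F_k} : x \in \mathcal{P}\}\bigr|.$$ Also, $\log^+(x) = \max(0,\log(x))$.
   Formalization: The logarithm of 0 is read as 0, so a shift of finite type with no periodic points has periodic entropy 0; with log 0 = −∞ the claim fails, e.g. for α = 0, where X_ω is empty with probability 1. *)

theory Defs
  imports "HOL-Probability.Probability"
begin

text \<open>The lattice \<open>\<int>\<^sup>d\<close> is the type \<open>int ^ 'd\<close>, so that \<open>d = CARD('d) \<ge> 1\<close>.\<close>

definition cube :: "nat \<Rightarrow> (int ^ 'd) set" where
  "cube n = {p. \<forall>i. 1 \<le> p $ i \<and> p $ i \<le> int n}"

definition shift :: "int ^ 'd \<Rightarrow> (int ^ 'd \<Rightarrow> 'a) \<Rightarrow> (int ^ 'd \<Rightarrow> 'a)" where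
  "shift p x = (\<lambda>q. x (p + q))"

definition patterns :: "'a set \<Rightarrow> nat \<Rightarrow> (int ^ 'd \<Rightarrow> 'a) set" where
  "patterns A n = cube n \<rightarrow>\<^sub>E A"

text \<open>Since patterns are identified up to translation, the restriction of \<open>x\<close> to \<open>cube n + p\<close>
  is represented by its translate to \<open>cube n\<close>, which is \<open>restrict (shift p x) (cube n)\<close>.\<close>

definition sft :: "'a set \<Rightarrow> nat \<Rightarrow> (int ^ 'd \<Rightarrow> 'a) set \<Rightarrow> (int ^ 'd \<Rightarrow> 'a) set" where
  "sft A n \<omega> = {x. (\<forall>q. x q \<in> A) \<and> (\<forall>p. restrict (shift p x) (cube n) \<in> \<omega>)}"

definition finite_orbit :: "(int ^ 'd \<Rightarrow> 'a) set \<Rightarrow> (int ^ 'd \<Rightarrow> 'a) set \<Rightarrow> bool" where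
  "finite_orbit X \<gamma> \<longleftrightarrow>
     \<gamma> \<noteq> {} \<and> finite \<gamma> \<and> \<gamma> \<subseteq> X \<and> (\<forall>x\<in>\<gamma>. {shift p x | p. True} = \<gamma>)"

definition periodic_points :: "(int ^ 'd \<Rightarrow> 'a) set \<Rightarrow> (int ^ 'd \<Rightarrow> 'a) set" where
  "periodic_points X = {x \<in> X. \<exists>\<gamma>. finite_orbit X \<gamma> \<and> x \<in> \<gamma>}"

text \<open>As \<open>ln 0 = 0\<close>, a shift without periodic points has periodic entropy 0. This is the
  convention under which the concentration around \<open>log_plus\<close> makes sense in the subcritical
  regime: for \<open>\<alpha> = 0\<close> the random shift is always empty.\<close>

definition periodic_entropy :: "(int ^ 'd \<Rightarrow> 'a) set \<Rightarrow> ereal" where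
  "periodic_entropy X =
     limsup (\<lambda>k. ereal (1 / real k ^ CARD('d) *
       ln (real (card {restrict x (cube k) | x. x \<in> periodic_points X}))))"

text \<open>Again by \<open>ln 0 = 0\<close>, this has the intended value \<open>0\<close> at \<open>x = 0\<close>.\<close>

definition log_plus :: "real \<Rightarrow> real" where
  "log_plus x = max 0 (ln x)"

definition random_patterns :: "'a set \<Rightarrow> nat \<Rightarrow> real \<Rightarrow> (int ^ 'd \<Rightarrow> 'a) set pmf" where
  "random_patterns A n \<alpha> =
     map_pmf (\<lambda>f. {u \<in> patterns A n. f u})
       (Pi_pmf (patterns A n) False (\<lambda>_. bernoulli_pmf \<alpha>))"

end

(* Compare n-windows on a cube of side k = C n, with C a large constant. The periodic entropy is at
   most (ln N) / k^d, where N is the number of patterns on the k-cube all of whose n-windows are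
   allowed. The expectation of N is a sum over patterns of alpha to the number of distinct windows.
   A window that repeats an earlier one can be reconstructed from a pointer, and O(k^(d-1)) pointers
   suffice to reconstruct all letters covered by repetitions, so patterns with r repetitions are
   rarer by a factor |A|^(-r), up to a subexponential entropy of the pointers. Markov's inequality
   then gives the upper bound.

   For the lower bound let alpha |A| > 1 and count the patterns on the torus (Z/k)^d whose k^d
   windows are distinct and allowed. If two such patterns share windows, then one of them can be
   reconstructed from the other on a region of at least n^d letters; hence the variance is smaller
   than the squared expectation by a factor (alpha |A|)^(-n^d), up to a subexponential term, and
   Chebyshev's inequality applies. By the pigeonhole principle many of the allowed patterns agree on
   a frame of width n, and these can be placed side by side freely to form periodic points. *)
theory Submission imports Defs "HOL-Real_Asymp.Real_Asymp" begin

section \<open>Boxes, covers and counting\<close>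

text \<open>The proportion between box and window is forced. With \<open>k = C * n\<close> a set of
  pointers costs a logarithm of order n^(d-1) ln n, negligible against the n^d of the claim; one
  pointer per repetition would cost too much, so the redundant region must be covered economically.
  The constant C is dictated by the boundary: the letters in excess of the window positions, and
  likewise the frame, make up a fraction of at most d/C of the box, and C is taken so large that
  this fraction times ln |A| is at most \<epsilon>/4. Repetitions translate into saved letters
  through the injection of a position into the lowest cell of its window: r repetitions cover at
  least r letters. Within one pattern pointers can chain and overlap, and a translation invariant
  total order keeps them acyclic. A torus of side k > 1 carries no such order. Distinctness of the
  windows there removes self-repetitions from the second moment, and the remaining pointers lead
  from one pattern to another, fixed one. For \<alpha> |A| \<le> 1 the lower bound holds without
  exception, since the entropy is never negative.\<close>

lemma vec_box_card:
  fixes B :: "'d::finite \<Rightarrow> 'b set"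
  assumes "\<And>i. finite (B i)"
  shows "finite {p :: 'b ^ 'd. \<forall>i. p $ i \<in> B i}"
    and "card {p :: 'b ^ 'd. \<forall>i. p $ i \<in> B i} = (\<Prod>i\<in>UNIV. card (B i))"
proof -
  have "bij_betw vec_nth {p :: 'b ^ 'd. \<forall>i. p $ i \<in> B i} (Pi\<^sub>E UNIV B)"
    by (rule bij_betw_byWitness[where f' = vec_lambda]) auto
  moreover have "finite (Pi\<^sub>E UNIV B)"
    using assms by (intro finite_PiE) auto
  moreover have "card (Pi\<^sub>E UNIV B) = (\<Prod>i\<in>UNIV. card (B i))"
    by (intro card_PiE) auto
  ultimately show "finite {p :: 'b ^ 'd. \<forall>i. p $ i \<in> B i}"
    and "card {p :: 'b ^ 'd. \<forall>i. p $ i \<in> B i} = (\<Prod>i\<in>UNIV. card (B i))"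
    by (auto simp: bij_betw_finite bij_betw_same_card)
qed

lemma int_box_card:
  fixes a b :: int
  shows "finite {p :: int ^ 'd::finite. \<forall>i. a \<le> p $ i \<and> p $ i \<le> b}"
    and "card {p :: int ^ 'd::finite. \<forall>i. a \<le> p $ i \<and> p $ i \<le> b} = nat (b - a + 1) ^ CARD('d)"
  using vec_box_card[of "\<lambda>_::'d. {a..b}"] by simp_all

lemma finite_cube [simp]: "finite (cube n)"
  unfolding cube_def by (rule int_box_card)

lemma card_cube [simp]: "card (cube n :: (int ^ 'd::finite) set) = n ^ CARD('d)"
  unfolding cube_def by (simp add: int_box_card)

lemma card_patterns [simp]:
  "card (patterns A n :: (int ^ 'd::finite \<Rightarrow> 'a) set) = card A ^ (n ^ CARD('d))"
  unfolding patterns_def by (subst card_PiE) simp_all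

lemma finite_patterns [simp]: "finite A \<Longrightarrow> finite (patterns A n)"
  unfolding patterns_def by (intro finite_PiE) auto

lemma cube_nonempty: "n > 0 \<Longrightarrow> 1 \<in> cube n"
  by (simp add: cube_def)

text \<open>In each line of a fixed coordinate direction \<open>i\<^sub>0\<close>, two extremal positions in every block
  of length \<open>n\<close> already cover everything that is covered by the positions of the block.\<close>
lemma translates_subcover:
  fixes R :: "(int ^ 'd::finite) set"
  assumes R: "R \<subseteq> {p. \<forall>i. 0 \<le> p $ i \<and> p $ i \<le> int k}" and n: "n > 0"
  obtains R' where "R' \<subseteq> R" "(\<Union>p\<in>R'. (+) p ` cube n) = (\<Union>p\<in>R. (+) p ` cube n)"
    "card R' \<le> 2 * ((k div n + 1) * (k + 1) ^ (CARD('d) - 1))"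
proof -
  define i0 :: 'd where "i0 = undefined"
  \<comment> \<open>The fibres of \<open>g\<close> are segments of \<open>n\<close> consecutive
    positions in direction \<open>i0\<close>. \<open>Y\<close> bounds their number, and the factor 2
    in the claim accounts for the extremal members \<open>lo\<close> and \<open>hi\<close> of
    \<open>R\<close> in each.\<close>
  define g :: "int ^ 'd \<Rightarrow> int ^ 'd"
    where "g p = (\<chi> i. if i = i0 then p $ i div int n else p $ i)" for p
  define Y where "Y = {y :: int ^ 'd. \<forall>i. y $ i \<in> (if i = i0 then {0..int (k div n)} else {0..int k})}"
  have finR: "finite R"
    using R int_box_card(1) finite_subset by blast
  have finY: "finite Y"
    unfolding Y_def by (rule vec_box_card) simp
  have cY: "card Y = (k div n + 1) * (k + 1) ^ (CARD('d) - 1)"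
  proof -
    have "card Y = (\<Prod>i\<in>(UNIV::'d set). card (if i = i0 then {0..int (k div n)} else {0..int k}))"
      unfolding Y_def by (rule vec_box_card) simp
    also have "\<dots> = (k div n + 1) * (\<Prod>i\<in>(UNIV::'d set) - {i0}. card (if i = i0 then {0..int (k div n)} else {0..int k}))"
      by (subst prod.remove[of _ i0]) (auto simp: nat_add_distrib simp flip: zdiv_int)
    also have "(\<Prod>i\<in>(UNIV::'d set) - {i0}. card (if i = i0 then {0..int (k div n)} else {0..int k}))
       = (\<Prod>i\<in>(UNIV::'d set) - {i0}. k + 1)"
      by (intro prod.cong) (auto simp: nat_add_distrib)
    finally show ?thesis by (simp add: card_Diff_singleton)
  qed
  have gY: "g ` R \<subseteq> Y"
    using R n by (auto simp: g_def Y_def zdiv_int zdiv_mono1 pos_imp_zdiv_nonneg_iff)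
  have "\<exists>a\<in>R. g a = y \<and> (\<forall>p\<in>R. g p = y \<longrightarrow> a $ i0 \<le> p $ i0)" if "y \<in> g ` R" for y
    using ex_is_arg_min_if_finite[of "{p\<in>R. g p = y}" "\<lambda>p. p $ i0"] finR that
    by (auto simp: is_arg_min_linorder)
  then obtain lo where lo: "\<And>y. y \<in> g ` R \<Longrightarrow> lo y \<in> R \<and> g (lo y) = y \<and> (\<forall>p\<in>R. g p = y \<longrightarrow> lo y $ i0 \<le> p $ i0)"
    by metis
  have "\<exists>a\<in>R. g a = y \<and> (\<forall>p\<in>R. g p = y \<longrightarrow> p $ i0 \<le> a $ i0)" if "y \<in> g ` R" for y
    using ex_is_arg_min_if_finite[of "{p\<in>R. g p = y}" "\<lambda>p. - (p $ i0)"] finR that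
    by (auto simp: is_arg_min_linorder)
  then obtain hi where hi: "\<And>y. y \<in> g ` R \<Longrightarrow> hi y \<in> R \<and> g (hi y) = y \<and> (\<forall>p\<in>R. g p = y \<longrightarrow> p $ i0 \<le> hi y $ i0)"
    by metis
  define R' where "R' = lo ` g ` R \<union> hi ` g ` R"
  have "R' \<subseteq> R"
    using lo hi by (auto simp: R'_def)
  moreover have "(\<Union>p\<in>R. (+) p ` cube n) \<subseteq> (\<Union>p\<in>R'. (+) p ` cube n)"
  proof
    fix x assume "x \<in> (\<Union>p\<in>R. (+) p ` cube n)"
    then obtain p s where p: "p \<in> R" "s \<in> cube n" "x = p + s" by auto
    define a b where "a = lo (g p)" and "b = hi (g p)"
    have a: "a \<in> R'" "g a = g p" "a $ i0 \<le> p $ i0" and b: "b \<in> R'" "g b = g p" "p $ i0 \<le> b $ i0"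
      using lo[of "g p"] hi[of "g p"] p by (auto simp: a_def b_def R'_def)
    have eqs: "a $ i = p $ i" "b $ i = p $ i" if "i \<noteq> i0" for i
      using arg_cong[OF a(2), of "\<lambda>v. v $ i"] arg_cong[OF b(2), of "\<lambda>v. v $ i"] that
      by (simp_all add: g_def)
    have "b $ i0 div int n = a $ i0 div int n"
      using arg_cong[OF a(2), of "\<lambda>v. v $ i0"] arg_cong[OF b(2), of "\<lambda>v. v $ i0"]
      by (simp add: g_def)
    then have diff: "b $ i0 - a $ i0 < int n"
      using n by (smt (verit) div_mult_mod_eq of_nat_0_less_iff pos_mod_bound pos_mod_sign)
    \<comment> \<open>Along direction \<open>i0\<close>, \<open>p\<close> lies between
      \<open>a\<close> and \<open>b\<close>, and \<open>b\<close> exceeds \<open>a\<close> by less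
      than \<open>n\<close>. So the intervals of length \<open>n\<close> started at \<open>a\<close>
      and \<open>b\<close> leave no gap and together contain the one started at
      \<open>p\<close>.\<close>
    show "x \<in> (\<Union>p\<in>R'. (+) p ` cube n)"
    proof (cases "p $ i0 + s $ i0 \<le> a $ i0 + int n")
      case True
      have "(x - a) $ i \<ge> 1 \<and> (x - a) $ i \<le> int n" for i
        using p(2) a(3) True eqs(1)[of i] unfolding p(3) cube_def
        by (cases "i = i0") (auto, smt (verit))
      then have "x - a \<in> cube n" unfolding cube_def by auto
      then have "x \<in> (+) a ` cube n" by (rule rev_image_eqI) simp
      then show ?thesis using a(1) by auto
    next
      case False
      have "1 \<le> s $ i" "s $ i \<le> int n" for i
        using p(2) by (simp_all add: cube_def)
      note s = this
      have "(x - b) $ i \<ge> 1 \<and> (x - b) $ i \<le> int n" for i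
      proof (cases "i = i0")
        case True
        then show ?thesis
          using s(2)[of i0] b(3) diff False unfolding p(3) by simp
      next
        case False
        then show ?thesis
          using s[of i] eqs(2)[of i] unfolding p(3) by simp
      qed
      then have "x - b \<in> cube n" unfolding cube_def by auto
      then have "x \<in> (+) b ` cube n" by (rule rev_image_eqI) simp
      then show ?thesis using b(1) by auto
    qed
  qed
  moreover have "card R' \<le> 2 * ((k div n + 1) * (k + 1) ^ (CARD('d) - 1))"
  proof -
    have "card R' \<le> card (lo ` g ` R) + card (hi ` g ` R)"
      unfolding R'_def by (rule card_Un_le)
    also have "\<dots> \<le> card (g ` R) + card (g ` R)"
      using finR by (intro add_mono card_image_le) auto
    also have "card (g ` R) \<le> card Y"
      using finY gY by (rule card_mono)
    finally show ?thesis using cY by simp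
  qed
  ultimately show thesis
    by (intro that[of R']) auto
qed

text \<open>Padding with \<open>None\<close> turns a set of at most \<open>c\<close> elements into a
  word of length exactly \<open>c\<close> over an alphabet with one symbol more than
  \<open>Q\<close>.\<close>

lemma card_subsets_le:
  assumes "finite Q"
  shows "finite {G. G \<subseteq> Q \<and> card G \<le> c}" "card {G. G \<subseteq> Q \<and> card G \<le> c} \<le> (card Q + 1) ^ c"
proof -
  define L where "L = {xs. set xs \<subseteq> insert None (Some ` Q) \<and> length xs = c}"
  have L: "finite L" "card L = (card Q + 1) ^ c"
    using assms by (auto simp: L_def finite_lists_length_eq card_lists_length_eq card_image)
  have sub: "{G. G \<subseteq> Q \<and> card G \<le> c} \<subseteq> (\<lambda>xs. {q. Some q \<in> set xs}) ` L"
  proof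
    fix G assume "G \<in> {G. G \<subseteq> Q \<and> card G \<le> c}"
    then have G: "G \<subseteq> Q" "card G \<le> c" by auto
    then obtain ys where ys: "set ys = G" "length ys = card G"
      using assms by (metis distinct_card finite_distinct_list finite_subset)
    define xs where "xs = map Some ys @ replicate (c - card G) None"
    have "xs \<in> L" "G = {q. Some q \<in> set xs}"
      using G ys by (auto simp: xs_def L_def)
    then show "G \<in> (\<lambda>xs. {q. Some q \<in> set xs}) ` L" by blast
  qed
  show "finite {G. G \<subseteq> Q \<and> card G \<le> c}"
    using assms by simp
  show "card {G. G \<subseteq> Q \<and> card G \<le> c} \<le> (card Q + 1) ^ c"
    using surj_card_le[OF L(1) sub] L(2) by simp
qed

text \<open>A weighted union bound. In the applications \<open>G\<close> is a set of pointers,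
  \<open>F G\<close> the patterns consistent with it, and \<open>b G\<close> bounds the weight of
  those patterns that choose \<open>G\<close>. A large family \<open>F G\<close> is harmless if
  \<open>b G\<close> compensates for its size.\<close>

lemma sum_le_card_cover:
  fixes f :: "'b \<Rightarrow> real" and b :: "'g \<Rightarrow> real"
  assumes fin: "finite S" "finite \<G>"
    and cover: "\<And>u. u \<in> S \<Longrightarrow> \<exists>G\<in>\<G>. u \<in> F G \<and> f u \<le> b G"
    and b: "\<And>G. G \<in> \<G> \<Longrightarrow> 0 \<le> b G" and finF: "\<And>G. G \<in> \<G> \<Longrightarrow> finite (F G)"
    and bound: "\<And>G. G \<in> \<G> \<Longrightarrow> real (card (F G)) * b G \<le> B"
  shows "(\<Sum>u\<in>S. f u) \<le> real (card \<G>) * B"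
proof -
  have "f u \<le> (\<Sum>G\<in>\<G>. if u \<in> F G then b G else 0)" if u: "u \<in> S" for u
  proof -
    obtain G where G: "G \<in> \<G>" "u \<in> F G" "f u \<le> b G" using cover[OF u] by auto
    have "(if u \<in> F G then b G else 0) \<le> (\<Sum>G\<in>\<G>. if u \<in> F G then b G else 0)"
      using G(1) fin b by (intro member_le_sum) auto
    then show ?thesis using G by simp
  qed
  then have "(\<Sum>u\<in>S. f u) \<le> (\<Sum>u\<in>S. \<Sum>G\<in>\<G>. if u \<in> F G then b G else 0)"
    by (intro sum_mono)
  also have "\<dots> = (\<Sum>G\<in>\<G>. \<Sum>u\<in>S. if u \<in> F G then b G else 0)"
    by (rule sum.swap)
  also have "\<dots> \<le> (\<Sum>G\<in>\<G>. B)"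
  proof (rule sum_mono)
    fix G assume G: "G \<in> \<G>"
    have "(\<Sum>u\<in>S. if u \<in> F G then b G else 0) = real (card {u\<in>S. u \<in> F G}) * b G"
      using fin by (simp flip: sum.inter_filter)
    also have "\<dots> \<le> real (card (F G)) * b G"
      using b[OF G] finF[OF G] by (intro mult_right_mono of_nat_mono card_mono) auto
    also have "\<dots> \<le> B" by (rule bound[OF G])
    finally show "(\<Sum>u\<in>S. if u \<in> F G then b G else 0) \<le> B" .
  qed
  finally show ?thesis by simp
qed

text \<open>Restriction to \<open>D - V\<close> is injective on \<open>F\<close>, so every letter
  that can be reconstructed saves a factor \<open>card A\<close>. The three reconstruction arguments
  (pointers within a pattern, two equal windows on the torus, copying from another pattern) all end
  here.\<close>

lemma card_determined_le:
  assumes "finite A" "finite D" "V \<subseteq> D" "F \<subseteq> D \<rightarrow>\<^sub>E A"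
    and "\<And>u v. u \<in> F \<Longrightarrow> v \<in> F \<Longrightarrow> (\<And>s. s \<in> D - V \<Longrightarrow> u s = v s) \<Longrightarrow> u = v"
  shows "card F \<le> card A ^ (card D - card V)"
proof -
  have "inj_on (\<lambda>u. restrict u (D - V)) F"
  proof (rule inj_onI)
    fix u v assume uv: "u \<in> F" "v \<in> F" and eq: "restrict u (D - V) = restrict v (D - V)"
    have "u s = v s" if "s \<in> D - V" for s
      using fun_cong[OF eq, of s] that by simp
    then show "u = v" by (rule assms(5)[OF uv])
  qed
  moreover have "(\<lambda>u. restrict u (D - V)) ` F \<subseteq> D - V \<rightarrow>\<^sub>E A"
  proof
    fix w assume "w \<in> (\<lambda>u. restrict u (D - V)) ` F"
    then obtain u where "u \<in> D \<rightarrow>\<^sub>E A" "w = restrict u (D - V)"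
      using assms(4) by auto
    then show "w \<in> D - V \<rightarrow>\<^sub>E A"
      by auto
  qed
  ultimately have "card F \<le> card (D - V \<rightarrow>\<^sub>E A)"
    using assms by (intro card_inj_on_le[where f = "\<lambda>u. restrict u (D - V)"]) (auto simp: finite_PiE)
  also have "\<dots> = card A ^ (card D - card V)"
    using assms by (subst card_PiE) (auto simp: card_Diff_subset finite_subset)
  finally show ?thesis .
qed

section \<open>Windows of patterns\<close>

definition window :: "nat \<Rightarrow> (int ^ 'd \<Rightarrow> 'a) \<Rightarrow> int ^ 'd \<Rightarrow> (int ^ 'd \<Rightarrow> 'a)" where
  "window n x p = restrict (shift p x) (cube n)"

lemma window_eqD: "window n x p = window n y q \<Longrightarrow> s \<in> cube n \<Longrightarrow> x (p + s) = y (q + s)"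
  unfolding window_def shift_def by (drule fun_cong[of _ _ s]) simp

lemma window_eqI: "(\<And>s. s \<in> cube n \<Longrightarrow> x (p + s) = y (q + s)) \<Longrightarrow> window n x p = window n y q"
  unfolding window_def shift_def by (auto simp: fun_eq_iff)

text \<open>\<open>cube\<close> starts at 1 and the window at \<open>p\<close> is read on
  \<open>p + cube n\<close>. Hence the corner is 0, and for 0 < n \<le> k these are exactly the
  positions whose window fits into \<open>cube k\<close>.\<close>

definition offsets :: "nat \<Rightarrow> nat \<Rightarrow> (int ^ 'd) set" where
  "offsets k n = {p. \<forall>i. 0 \<le> p $ i \<and> p $ i \<le> int (k - n)}"

text \<open>An upper bound for the number of sets of pairs \<open>(p, q)\<close> of positions in \<open>[0,k]\<^sup>d\<close>
  whose cardinality does not exceed the bound of \<open>translates_subcover\<close>.\<close>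
definition encodings :: "nat \<Rightarrow> nat \<Rightarrow> nat \<Rightarrow> nat" where
  "encodings d n k = ((k + 1) ^ d * (k + 1) ^ d + 1) ^ (2 * ((k div n + 1) * (k + 1) ^ (d - 1)))"

lemma finite_offsets [simp]: "finite (offsets k n)"
  unfolding offsets_def by (rule int_box_card)

lemma card_offsets: "n \<le> k \<Longrightarrow> card (offsets k n :: (int ^ 'd::finite) set) = (k - n + 1) ^ CARD('d)"
  unfolding offsets_def by (subst int_box_card) (simp add: nat_add_distrib del: of_nat_diff)

lemma offsets_add_cube: "n \<le> k \<Longrightarrow> p \<in> offsets k n \<Longrightarrow> s \<in> cube n \<Longrightarrow> p + s \<in> cube k"
proof -
  assume nk: "n \<le> k" and p: "p \<in> offsets k n" and s: "s \<in> cube n"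
  have "1 \<le> (p + s) $ i \<and> (p + s) $ i \<le> int k" for i
  proof -
    have "0 \<le> p $ i" "p $ i \<le> int (k - n)" "1 \<le> s $ i" "s $ i \<le> int n"
      using p s by (auto simp: offsets_def cube_def)
    then show ?thesis using nk by simp
  qed
  then show "p + s \<in> cube k" by (simp add: cube_def)
qed

text \<open>Lexicographic comparison along an arbitrary enumeration \<open>e\<close> of the
  coordinates. Of two positions with equal windows the smaller one becomes the target of the
  pointer, and translation invariance passes this direction on to every letter of the
  window.\<close>

lemma translation_invariant_order:
  obtains L :: "int ^ 'd::finite \<Rightarrow> int ^ 'd \<Rightarrow> bool"
  where "\<And>p. \<not> L p p" "\<And>p q r. L p q \<Longrightarrow> L q r \<Longrightarrow> L p r"
    "\<And>p q. p \<noteq> q \<Longrightarrow> L p q \<or> L q p" "\<And>p q s. L p q \<Longrightarrow> L (p + s) (q + s)"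
proof -
  obtain e :: "'d \<Rightarrow> nat" where e: "inj e"
    using finite_imp_inj_to_nat_seg[of "UNIV :: 'd set"] by auto
  define L :: "int ^ 'd \<Rightarrow> int ^ 'd \<Rightarrow> bool"
    where "L p q \<longleftrightarrow> (\<exists>i. p $ i < q $ i \<and> (\<forall>j. e j < e i \<longrightarrow> p $ j = q $ j))" for p q
  show thesis
  proof (rule that[of L])
    show "\<not> L p p" for p by (simp add: L_def)
    show "L (p + s) (q + s)" if "L p q" for p q s using that by (simp add: L_def)
  next
    fix p q r assume "L p q" "L q r"
    then obtain i j where i: "p $ i < q $ i" "\<And>l. e l < e i \<Longrightarrow> p $ l = q $ l"
      and j: "q $ j < r $ j" "\<And>l. e l < e j \<Longrightarrow> q $ l = r $ l"
      unfolding L_def by blast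
    consider "e i < e j" | "e j < e i" | "i = j"
      using e by (metis injD linorder_neqE_nat)
    then show "L p r"
    proof cases
      case 1
      then have "p $ i < r $ i \<and> (\<forall>l. e l < e i \<longrightarrow> p $ l = r $ l)"
        using i j by auto
      then show ?thesis unfolding L_def by blast
    next
      case 2
      then have "p $ j < r $ j \<and> (\<forall>l. e l < e j \<longrightarrow> p $ l = r $ l)"
        using i j by auto
      then show ?thesis unfolding L_def by blast
    next
      case 3
      then have "p $ i < r $ i \<and> (\<forall>l. e l < e i \<longrightarrow> p $ l = r $ l)"
        using i j by auto
      then show ?thesis unfolding L_def by blast
    qed
  next
    fix p q :: "int ^ 'd" assume "p \<noteq> q"
    then have "\<exists>i. p $ i \<noteq> q $ i" by (simp add: vec_eq_iff)
    then obtain i where i: "p $ i \<noteq> q $ i" "\<And>j. p $ j \<noteq> q $ j \<Longrightarrow> e i \<le> e j"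
      using ex_has_least_nat[of "\<lambda>i. p $ i \<noteq> q $ i" _ e] by blast
    have "p $ j = q $ j" if "e j < e i" for j
      using i(2)[of j] that by linarith
    then show "L p q \<or> L q p"
      using i(1) unfolding L_def by (metis linorder_neqE)
  qed
qed

text \<open>Positions whose window has occurred before are redundant, and the redundant letters are
  recovered from the others by following pointers that decrease in a translation invariant order.\<close>
lemma card_determined_by_pointers:
  fixes L :: "int ^ 'd::finite \<Rightarrow> int ^ 'd \<Rightarrow> bool"
  assumes L: "\<And>p. \<not> L p p" "\<And>p q r. L p q \<Longrightarrow> L q r \<Longrightarrow> L p r" "\<And>p q s. L p q \<Longrightarrow> L (p + s) (q + s)"
    and A: "finite A" and nk: "n \<le> k"
    and G: "G \<subseteq> offsets k n \<times> offsets k n" "\<And>p q. (p, q) \<in> G \<Longrightarrow> L q p"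
  shows "card {u \<in> patterns A k. \<forall>(p, q) \<in> G. window n u p = window n u q}
    \<le> card A ^ (k ^ CARD('d) - card (\<Union>p\<in>fst ` G. (+) p ` cube n))"
proof -
  define U where "U = (\<Union>p\<in>fst ` G. (+) p ` cube n)"
  have "card {u \<in> patterns A k. \<forall>(p, q) \<in> G. window n u p = window n u q}
      \<le> card A ^ (card (cube k :: (int ^ 'd) set) - card U)"
  proof (rule card_determined_le)
    show "U \<subseteq> cube k"
      using G(1) offsets_add_cube[OF nk] by (fastforce simp: U_def)
    show "{u \<in> patterns A k. \<forall>(p, q) \<in> G. window n u p = window n u q} \<subseteq> cube k \<rightarrow>\<^sub>E A"
      by (auto simp: patterns_def)
  next
    fix u v
    assume u: "u \<in> {u \<in> patterns A k. \<forall>(p, q) \<in> G. window n u p = window n u q}"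
      and v: "v \<in> {u \<in> patterns A k. \<forall>(p, q) \<in> G. window n u p = window n u q}"
      and eq: "\<And>s. s \<in> cube k - U \<Longrightarrow> u s = v s"
    \<comment> \<open>A translation invariant order need not be well-founded on the lattice. The
      number of smaller cells inside \<open>cube k\<close> still decreases along pointers, as these
      stay within the cube.\<close>
    have *: "u s = v s" if "s \<in> cube k" for s
      using that
    proof (induction "card {t \<in> cube k. L t s}" arbitrary: s rule: less_induct)
      case less
      show ?case
      proof (cases "s \<in> U")
        case False
        then show ?thesis using eq less.prems by auto
      next
        case True
        then obtain p q t where t: "(p, q) \<in> G" "t \<in> cube n" "s = p + t"
          by (auto simp: U_def)
        have qt: "q + t \<in> cube k"
          using t G(1) by (intro offsets_add_cube[OF nk]) auto
        have Lqs: "L (q + t) s"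
          using G(2)[OF t(1)] L(3) t(3) by auto
        have "{r \<in> cube k. L r (q + t)} \<subset> {r \<in> cube k. L r s}"
          using Lqs L(1)[of "q + t"] L(2) qt by blast
        then have "card {r \<in> cube k. L r (q + t)} < card {r \<in> cube k. L r s}"
          by (intro psubset_card_mono) auto
        then have "u (q + t) = v (q + t)"
          using qt by (rule less.hyps)
        moreover have "u s = u (q + t)"
          unfolding t(3) using u t by (intro window_eqD[of n]) auto
        moreover have "v s = v (q + t)"
          unfolding t(3) using v t by (intro window_eqD[of n]) auto
        ultimately show ?thesis by simp
      qed
    qed
    show "u = v"
      using u v * by (intro PiE_ext[of u "cube k" "\<lambda>_. A" v]) (auto simp: patterns_def)
  qed (use A in auto)
  then show ?thesis by (simp add: U_def)
qed

text \<open>Let \<open>U\<close> be the region covered by repeated windows. At least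
  \<open>K - card U\<close> windows are distinct, and at most \<open>k^d - card U\<close> letters
  are free. For \<open>card U \<le> K\<close> a set of pointers therefore contributes at most
  |A|^(k^d - K) times the power of \<alpha> |A| with exponent \<open>K - card U\<close>. The first
  factor is the boundary loss; the \<open>max\<close> covers both signs of ln (\<alpha>
  |A|).\<close>

lemma first_moment_bound:
  fixes A :: "'a set" and \<alpha> :: real
  assumes A: "finite A" "A \<noteq> {}" and \<alpha>: "0 \<le> \<alpha>" "\<alpha> \<le> 1" and n: "n > 0" "n \<le> k"
  defines "K \<equiv> (k - n + 1) ^ CARD('d::finite)"
  shows "(\<Sum>u\<in>patterns A k. \<alpha> ^ card (window n u ` (offsets k n :: (int ^ 'd) set)))
    \<le> real (encodings CARD('d) n k) *
      (real (card A) ^ (k ^ CARD('d) - K) * max 1 (\<alpha> * card A) ^ K)"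
proof -
  define m where "m = real (card A)"
  have m: "m \<ge> 1" using A by (simp add: m_def Suc_leI card_gt_0_iff)
  obtain L :: "int ^ 'd \<Rightarrow> int ^ 'd \<Rightarrow> bool" where
    L: "\<And>p. \<not> L p p" "\<And>p q r. L p q \<Longrightarrow> L q r \<Longrightarrow> L p r"
       "\<And>p q. p \<noteq> q \<Longrightarrow> L p q \<or> L q p" "\<And>p q s. L p q \<Longrightarrow> L (p + s) (q + s)"
    using translation_invariant_order by metis
  define O' where "O' = (offsets k n :: (int ^ 'd) set)"
  define Q where "Q = {(p, q) \<in> O' \<times> O'. L q p}"
  define c where "c = 2 * ((k div n + 1) * (k + 1) ^ (CARD('d) - 1))"
  define \<G> where "\<G> = {G. G \<subseteq> Q \<and> card G \<le> c}"
  define U where "U G = (\<Union>p\<in>fst ` G. (+) p ` (cube n :: (int ^ 'd) set))"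
    for G :: "((int ^ 'd) \<times> (int ^ 'd)) set"
  define F where "F G = {u \<in> patterns A k. \<forall>(p, q) \<in> G. window n u p = window n u q}"
    for G :: "((int ^ 'd) \<times> (int ^ 'd)) set"
  have QO: "Q \<subseteq> O' \<times> O'" by (auto simp: Q_def)
  have finO: "finite O'" by (simp add: O'_def)
  have finQ: "finite Q" using QO finO finite_subset by blast
  have cO: "card O' = K" unfolding O'_def K_def by (rule card_offsets[OF n(2)])
  have KK: "K \<le> k ^ CARD('d)" unfolding K_def using n by (intro power_mono) auto
  have cQ: "card Q \<le> (k + 1) ^ CARD('d) * (k + 1) ^ CARD('d)"
  proof -
    have "card Q \<le> card (O' \<times> O')" using finO QO by (intro card_mono) auto
    also have "\<dots> = K * K" by (simp add: card_cartesian_product cO)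
    also have "\<dots> \<le> (k + 1) ^ CARD('d) * (k + 1) ^ CARD('d)"
      unfolding K_def by (intro mult_mono power_mono) auto
    finally show ?thesis .
  qed
  have c\<G>: "card \<G> \<le> encodings CARD('d) n k"
  proof -
    have "card \<G> \<le> (card Q + 1) ^ c"
      unfolding \<G>_def by (rule card_subsets_le[OF finQ])
    also have "\<dots> \<le> encodings CARD('d) n k"
      unfolding encodings_def c_def using cQ by (intro power_mono) auto
    finally show ?thesis .
  qed
  have finU: "finite (U G)" if "G \<in> \<G>" for G
    using finite_subset[OF _ finQ, of G] that by (simp add: \<G>_def U_def)
  have "(\<Sum>u\<in>patterns A k. \<alpha> ^ card (window n u ` O'))
      \<le> real (card \<G>) * (m ^ (k ^ CARD('d) - K) * max 1 (\<alpha> * m) ^ K)"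
  proof (rule sum_le_card_cover[where F = F and b = "\<lambda>G. \<alpha> ^ (K - card (U G))"])
    show "finite (patterns A k :: (int ^ 'd \<Rightarrow> 'a) set)" using A by simp
    show "finite \<G>" unfolding \<G>_def by (rule card_subsets_le[OF finQ])
  next
    fix u :: "int ^ 'd \<Rightarrow> 'a" assume u: "u \<in> patterns A k"
    define R where "R = {p \<in> O'. \<exists>q\<in>O'. L q p \<and> window n u p = window n u q}"
    have RO: "R \<subseteq> O'" by (auto simp: R_def)
    have "R \<subseteq> {p. \<forall>i. 0 \<le> p $ i \<and> p $ i \<le> int k}"
    proof
      fix p assume "p \<in> R"
      then have p: "0 \<le> p $ i" "p $ i \<le> int (k - n)" for i
        by (auto simp: R_def O'_def offsets_def)
      have "p $ i \<le> int k" for i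
        by (rule order_trans[OF p(2)]) simp
      then show "p \<in> {p. \<forall>i. 0 \<le> p $ i \<and> p $ i \<le> int k}"
        using p(1) by simp
    qed
    then obtain R' where R': "R' \<subseteq> R" "(\<Union>p\<in>R'. (+) p ` cube n) = (\<Union>p\<in>R. (+) p ` cube n)" "card R' \<le> c"
      unfolding c_def by (rule translates_subcover[OF _ n(1)])
    have "\<forall>p\<in>R. \<exists>q. q\<in>O' \<and> L q p \<and> window n u p = window n u q"
      by (auto simp: R_def)
    then obtain f where f: "\<And>p. p \<in> R \<Longrightarrow> f p \<in> O' \<and> L (f p) p \<and> window n u p = window n u (f p)"
      by metis
    define G where "G = (\<lambda>p. (p, f p)) ` R'"
    have finR: "finite R" using RO finO finite_subset by blast
    then have "card G \<le> card R'"
      unfolding G_def by (intro card_image_le) (rule finite_subset[OF R'(1)])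
    then have "card G \<le> c" using R'(3) by simp
    then have G: "G \<in> \<G>"
      using f R' RO by (auto simp: \<G>_def Q_def G_def)
    have UG: "U G = (\<Union>p\<in>R. (+) p ` cube n)"
      unfolding U_def R'(2)[symmetric] G_def image_image by simp
    \<comment> \<open>The map to the lowest cell \<open>p + 1\<close> of the window is injective, so
      there are at least as many redundant letters as repetitions.\<close>
    have "card R \<le> card (U G)"
      using finU[OF G] cube_nonempty[OF n(1)] unfolding UG
      by (intro card_inj_on_le[of "\<lambda>p. p + 1"]) (auto simp: inj_on_def)
    moreover have "card (O' - R) \<le> card (window n u ` O')"
    proof (rule card_inj_on_le[of "window n u"])
      show "inj_on (window n u) (O' - R)"
      proof (rule inj_onI, rule ccontr)
        fix p q assume "p \<in> O' - R" "q \<in> O' - R" "window n u p = window n u q" "p \<noteq> q"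
        then show False using L(3)[of p q] by (auto simp: R_def)
      qed
    qed (use finO in auto)
    moreover have "card (O' - R) = K - card R"
      using card_Diff_subset[OF finR RO] cO by simp
    ultimately have "K - card (U G) \<le> card (window n u ` O')" by linarith
    then have "\<alpha> ^ card (window n u ` O') \<le> \<alpha> ^ (K - card (U G))"
      using \<alpha> by (intro power_decreasing) auto
    moreover have "u \<in> F G"
      using u f R' by (auto simp: F_def G_def)
    ultimately show "\<exists>G\<in>\<G>. u \<in> F G \<and> \<alpha> ^ card (window n u ` O') \<le> \<alpha> ^ (K - card (U G))"
      using G by auto
  next
    fix G assume G: "G \<in> \<G>"
    show "0 \<le> \<alpha> ^ (K - card (U G))" using \<alpha> by simp
    show "finite (F G)" using A by (simp add: F_def)
    have "card (F G) \<le> card A ^ (k ^ CARD('d) - card (U G))"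
      unfolding F_def U_def using G QO L(1,2,4) A n
      by (intro card_determined_by_pointers[of L]) (auto simp: \<G>_def Q_def O'_def)
    then have cF: "real (card (F G)) \<le> m ^ (k ^ CARD('d) - card (U G))"
      unfolding m_def by (metis of_nat_mono of_nat_power)
    have mx: "1 \<le> max 1 (\<alpha> * m) ^ j" for j by (intro one_le_power) simp
    \<comment> \<open>The box can have more cells than window positions, so
      \<open>card (U G)\<close> may exceed \<open>K\<close>. The truncated exponent of \<alpha> is
      then 0, and the saved letters alone give the bound.\<close>
    have "m ^ (k ^ CARD('d) - card (U G)) * \<alpha> ^ (K - card (U G))
        \<le> m ^ (k ^ CARD('d) - K) * max 1 (\<alpha> * m) ^ K"
    proof (cases "card (U G) \<le> K")
      case True
      have "m ^ (k ^ CARD('d) - card (U G)) = m ^ (k ^ CARD('d) - K) * m ^ (K - card (U G))"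
        using True KK by (simp flip: power_add)
      then have "m ^ (k ^ CARD('d) - card (U G)) * \<alpha> ^ (K - card (U G))
          = m ^ (k ^ CARD('d) - K) * (\<alpha> * m) ^ (K - card (U G))"
        by (simp add: power_mult_distrib)
      also have "\<dots> \<le> m ^ (k ^ CARD('d) - K) * max 1 (\<alpha> * m) ^ (K - card (U G))"
        using m \<alpha> by (intro mult_left_mono power_mono) auto
      also have "\<dots> \<le> m ^ (k ^ CARD('d) - K) * max 1 (\<alpha> * m) ^ K"
        using m by (intro mult_left_mono power_increasing) auto
      finally show ?thesis .
    next
      case False
      then have "m ^ (k ^ CARD('d) - card (U G)) * \<alpha> ^ (K - card (U G)) \<le> m ^ (k ^ CARD('d) - K) * 1"
        using m by (auto intro!: power_increasing)
      also have "\<dots> \<le> m ^ (k ^ CARD('d) - K) * max 1 (\<alpha> * m) ^ K"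
        using m mx by (intro mult_left_mono) auto
      finally show ?thesis .
    qed
    moreover have "real (card (F G)) * \<alpha> ^ (K - card (U G))
        \<le> m ^ (k ^ CARD('d) - card (U G)) * \<alpha> ^ (K - card (U G))"
      using cF \<alpha> by (intro mult_right_mono) auto
    ultimately show "real (card (F G)) * \<alpha> ^ (K - card (U G))
        \<le> m ^ (k ^ CARD('d) - K) * max 1 (\<alpha> * m) ^ K" by linarith
  qed
  also have "\<dots> \<le> real (encodings CARD('d) n k) * (m ^ (k ^ CARD('d) - K) * max 1 (\<alpha> * m) ^ K)"
    using c\<G> m by (intro mult_right_mono) auto
  finally show ?thesis unfolding O'_def m_def .
qed

section \<open>Patterns on the torus\<close>

text \<open>Residues are represented by 1, ..., k to match \<open>cube k\<close>; hence the shift by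
  one around \<open>mod\<close>.\<close>

definition res :: "nat \<Rightarrow> int ^ 'd \<Rightarrow> int ^ 'd" where
  "res k q = (\<chi> i. (q $ i - 1) mod int k + 1)"

definition periodize :: "nat \<Rightarrow> (int ^ 'd \<Rightarrow> 'a) \<Rightarrow> (int ^ 'd \<Rightarrow> 'a)" where
  "periodize k u = (\<lambda>q. u (res k q))"

definition torus_windows :: "nat \<Rightarrow> nat \<Rightarrow> (int ^ 'd \<Rightarrow> 'a) \<Rightarrow> (int ^ 'd \<Rightarrow> 'a) set" where
  "torus_windows n k u = window n (periodize k u) ` cube k"

definition repeat_free :: "'a set \<Rightarrow> nat \<Rightarrow> nat \<Rightarrow> (int ^ 'd \<Rightarrow> 'a) set" where
  "repeat_free A n k = {u \<in> patterns A k. inj_on (window n (periodize k u)) (cube k)}"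

lemma res_in_cube [simp]: "k > 0 \<Longrightarrow> res k q \<in> cube k"
  by (simp add: res_def cube_def add1_zle_eq)

lemma res_id: "q \<in> cube k \<Longrightarrow> res k q = q"
  proof -
  assume "q \<in> cube k"
  then have "1 \<le> q $ i" "q $ i \<le> int k" for i by (simp_all add: cube_def)
  then have "(q $ i - 1) mod int k = q $ i - 1" for i
    by (smt (verit) mod_pos_pos_trivial)
  then show "res k q = q" by (simp add: res_def vec_eq_iff)
qed

lemma res_eq_iff: "res k p = res k q \<longleftrightarrow> (\<forall>i. int k dvd p $ i - q $ i)"
  by (simp add: res_def vec_eq_iff mod_eq_dvd_iff)

lemma dvd_res_diff: "int k dvd res k p $ i - p $ i"
proof -
  have "res k p $ i - p $ i = - (int k * ((p $ i - 1) div int k))"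
    unfolding res_def by (simp add: minus_mult_div_eq_mod [symmetric])
  then show ?thesis by simp
qed

lemma res_add: "res k (res k p + q) = res k (p + q)"
  unfolding res_eq_iff using dvd_res_diff[of k p] by simp

lemma small_dvd_int: "int k dvd a \<Longrightarrow> \<bar>a\<bar> < int k \<Longrightarrow> a = 0"
  using dvd_imp_le_int[of a "int k"] by fastforce

lemma inj_on_res: "n \<le> k \<Longrightarrow> inj_on (\<lambda>s. res k (p + s)) (cube n)"
proof (rule inj_onI)
  fix s t assume nk: "n \<le> k" and st: "s \<in> cube n" "t \<in> cube n" and eq: "res k (p + s) = res k (p + t)"
  have "s $ i = t $ i" for i
  proof -
    have "1 \<le> s $ i" "s $ i \<le> int n" "1 \<le> t $ i" "t $ i \<le> int n"
      using st by (auto simp: cube_def)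
    moreover have "int k dvd s $ i - t $ i"
      using eq by (simp add: res_eq_iff)
    ultimately show ?thesis
      using nk small_dvd_int[of k "s $ i - t $ i"] by simp
  qed
  then show "s = t" by (simp add: vec_eq_iff)
qed

lemma periodize_res: "periodize k u (res k p + s) = periodize k u (p + s)"
  by (simp add: periodize_def res_add)

lemma window_periodize_res: "window n (periodize k u) (res k p) = window n (periodize k u) p"
  by (rule window_eqI) (rule periodize_res)

lemma finite_torus_windows [simp]: "finite (torus_windows n k u)"
  by (simp add: torus_windows_def)

lemma finite_repeat_free [simp]: "finite A \<Longrightarrow> finite (repeat_free A n k)"
  by (simp add: repeat_free_def)

lemma card_torus_windows:
  "(u :: int ^ 'd::finite \<Rightarrow> 'a) \<in> repeat_free A n k \<Longrightarrow> card (torus_windows n k u) = k ^ CARD('d)"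
  by (simp add: repeat_free_def torus_windows_def card_image)

lemma periodize_in_A: "u \<in> patterns A k \<Longrightarrow> k > 0 \<Longrightarrow> periodize k u q \<in> A"
  using res_in_cube[of k q] by (auto simp: patterns_def periodize_def)

lemma torus_windows_subset_patterns: "u \<in> patterns A k \<Longrightarrow> k > 0 \<Longrightarrow> torus_windows n k u \<subseteq> patterns A n"
  using periodize_in_A[of u A k]
  by (auto simp: torus_windows_def window_def shift_def patterns_def[of A n])

lemma periodize_in_sft_iff:
  assumes "u \<in> patterns A k" "k > 0"
  shows "periodize k u \<in> sft A n \<omega> \<longleftrightarrow> torus_windows n k u \<subseteq> \<omega>"
proof -
  have "window n (periodize k u) p \<in> torus_windows n k u" for p
    using res_in_cube[OF assms(2), of p] window_periodize_res[of n k u p]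
    unfolding torus_windows_def by (metis imageI)
  then show ?thesis
    using periodize_in_A[OF assms] unfolding sft_def torus_windows_def window_def by auto
qed

text \<open>The letter at \<open>p + s\<close> equals the one at \<open>q + s\<close>. If that cell
  belongs to the window at \<open>p\<close> again, say as \<open>p + s'\<close>, then
  \<open>s'\<close> exceeds \<open>s\<close> in coordinate \<open>i\<close> by the residue of
  \<open>q $ i - p $ i\<close>: the upper bound \<open>k - n\<close> on this residue rules out a
  wrap-around. So the recursion climbs and leaves the window, even if the two windows
  overlap.\<close>

lemma card_equal_torus_windows_aux:
  fixes p q :: "int ^ 'd::finite" and A :: "'a set"
  assumes A: "finite A" and n: "n > 0" "2 * n \<le> k"
    and t: "0 < (q $ i - p $ i) mod int k" "(q $ i - p $ i) mod int k \<le> int (k - n)"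
  shows "card {u \<in> patterns A k. window n (periodize k u) p = window n (periodize k u) q}
    \<le> card A ^ (k ^ CARD('d) - n ^ CARD('d))"
proof -
  define V where "V = (\<lambda>s. res k (p + s)) ` cube n"
  have cV: "card V = n ^ CARD('d)"
    unfolding V_def using n by (subst card_image) (auto intro: inj_on_res)
  have k: "k > 0" using n by simp
  have "card {u \<in> patterns A k. window n (periodize k u) p = window n (periodize k u) q}
      \<le> card A ^ (card (cube k :: (int ^ 'd) set) - card V)"
  proof (rule card_determined_le)
    show "V \<subseteq> cube k" using k by (auto simp: V_def)
    show "{u \<in> patterns A k. window n (periodize k u) p = window n (periodize k u) q} \<subseteq> cube k \<rightarrow>\<^sub>E A"
      by (auto simp: patterns_def)
  next
    fix u v
    assume u: "u \<in> {u \<in> patterns A k. window n (periodize k u) p = window n (periodize k u) q}"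
      and v: "v \<in> {u \<in> patterns A k. window n (periodize k u) p = window n (periodize k u) q}"
      and eq: "\<And>s. s \<in> cube k - V \<Longrightarrow> u s = v s"
    have *: "periodize k u (p + s) = periodize k v (p + s)" if "s \<in> cube n" for s
      using that
    proof (induction "nat (int n - s $ i)" arbitrary: s rule: less_induct)
      case less
      have step: "periodize k u (p + s) = periodize k u (q + s)"
        "periodize k v (p + s) = periodize k v (q + s)"
        using u v less.prems by (auto intro: window_eqD)
      have "periodize k u (q + s) = periodize k v (q + s)"
      proof (cases "res k (q + s) \<in> V")
        case False
        then show ?thesis
          using eq[of "res k (q + s)"] k by (simp add: periodize_def)
      next
        case True
        then obtain s' where s': "s' \<in> cube n" "res k (q + s) = res k (p + s')"
          by (auto simp: V_def)
        have b: "1 \<le> s $ i" "s $ i \<le> int n" "1 \<le> s' $ i" "s' $ i \<le> int n"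
          using less.prems s'(1) by (auto simp: cube_def)
        define t where "t = (q $ i - p $ i) mod int k"
        have "int k dvd (q $ i - p $ i) - t"
          unfolding t_def by (simp add: minus_mod_eq_mult_div)
        moreover have "int k dvd (q + s) $ i - (p + s') $ i"
          using s'(2) by (simp only: res_eq_iff)
        ultimately have "int k dvd ((q + s) $ i - (p + s') $ i) - ((q $ i - p $ i) - t)"
          by (rule dvd_diff[rotated])
        then have "int k dvd t + s $ i - s' $ i" by (simp add: algebra_simps)
        moreover have "\<bar>t + s $ i - s' $ i\<bar> < int k"
          using b assms(4,5) n unfolding t_def[symmetric] by (simp add: abs_less_iff)
        ultimately have "s' $ i = s $ i + t"
          using small_dvd_int[of k "t + s $ i - s' $ i"] by simp
        then have "nat (int n - s' $ i) < nat (int n - s $ i)"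
          using b assms(4) unfolding t_def[symmetric] by simp
        then have "periodize k u (p + s') = periodize k v (p + s')"
          using s'(1) by (rule less.hyps)
        then show ?thesis using s'(2) by (simp add: periodize_def)
      qed
      then show ?case using step by simp
    qed
    have "u z = v z" if "z \<in> cube k" for z
    proof (cases "z \<in> V")
      case True
      then show ?thesis using * by (auto simp: V_def periodize_def)
    next
      case False
      then show ?thesis using eq that by auto
    qed
    then show "u = v"
      using u v by (intro PiE_ext[of u "cube k" "\<lambda>_. A" v]) (auto simp: patterns_def)
  qed (use A in auto)
  then show ?thesis by (simp add: cV)
qed

lemma card_equal_torus_windows:
  fixes p q :: "int ^ 'd::finite" and A :: "'a set"
  assumes A: "finite A" and n: "n > 0" "2 * n \<le> k" and pq: "p \<in> cube k" "q \<in> cube k" "p \<noteq> q"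
  shows "card {u \<in> patterns A k. window n (periodize k u) p = window n (periodize k u) q}
    \<le> card A ^ (k ^ CARD('d) - n ^ CARD('d))"
proof -
  obtain i where i: "p $ i \<noteq> q $ i" using pq(3) by (auto simp: vec_eq_iff)
  have b: "1 \<le> p $ i" "p $ i \<le> int k" "1 \<le> q $ i" "q $ i \<le> int k"
    using pq by (auto simp: cube_def)
  have k: "int k > 0" using n by simp
  define t where "t = (q $ i - p $ i) mod int k"
  have t: "0 < t" "t < int k"
  proof -
    have "t \<noteq> 0"
    proof
      assume "t = 0"
      then have "int k dvd q $ i - p $ i" by (simp add: t_def mod_eq_0_iff_dvd)
      moreover have "\<bar>q $ i - p $ i\<bar> < int k" using b by linarith
      ultimately show False using small_dvd_int[of k "q $ i - p $ i"] i by simp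
    qed
    then show "0 < t" "t < int k"
      unfolding t_def using pos_mod_sign[OF k, of "q $ i - p $ i"] pos_mod_bound[OF k, of "q $ i - p $ i"] by linarith+
  qed
  have "(p $ i - q $ i) mod int k = int k - t"
    using t zmod_zminus1_eq_if[of "q $ i - p $ i" "int k"] by (simp add: t_def split: if_splits)
  \<comment> \<open>If \<open>t\<close> exceeds \<open>k - n\<close>, then
    \<open>k - t < n \<le> k - n\<close> because of \<open>2 * n \<le> k\<close>, and exchanging
    \<open>p\<close> and \<open>q\<close> replaces \<open>t\<close> by \<open>k - t\<close>.\<close>
  moreover have "t \<le> int (k - n) \<or> int k - t \<le> int (k - n)"
    using t n by auto
  ultimately consider "t \<le> int (k - n)" | "0 < (p $ i - q $ i) mod int k" "(p $ i - q $ i) mod int k \<le> int (k - n)"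
    using t by auto
  then show ?thesis
  proof cases
    case 1
    then show ?thesis
      using t card_equal_torus_windows_aux[OF A n, of q i p] by (simp add: t_def)
  next
    case 2
    then show ?thesis
      using card_equal_torus_windows_aux[OF A n, of p i q] by (simp add: eq_commute)
  qed
qed

text \<open>A union bound over at most k^(2d) pairs of positions. A coincidence costs a factor
  |A|^(n^d), and \<open>large\<close> keeps the total loss below half of all patterns.\<close>

lemma card_repeat_free:
  fixes A :: "'a set"
  assumes A: "finite A" and n: "n > 0" "2 * n \<le> k"
    and large: "2 * (k ^ CARD('d::finite) * k ^ CARD('d)) \<le> card A ^ (n ^ CARD('d))"
  shows "card A ^ (k ^ CARD('d)) \<le> 2 * card (repeat_free A n k :: (int ^ 'd \<Rightarrow> 'a) set)"
proof -
  let ?F = "\<lambda>(p, q). {u \<in> patterns A k. window n (periodize k u) p = window n (periodize k u) (q :: int ^ 'd)}"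
  define Q where "Q = {(p, q) \<in> cube k \<times> cube k. p \<noteq> (q :: int ^ 'd)}"
  have Q: "finite Q" "card Q \<le> k ^ CARD('d) * k ^ CARD('d)"
  proof -
    have "Q \<subseteq> cube k \<times> cube k" by (auto simp: Q_def)
    then show "finite Q" "card Q \<le> k ^ CARD('d) * k ^ CARD('d)"
      using card_mono[of "cube k \<times> cube k" Q] finite_subset[of Q "cube k \<times> cube k"]
      by (auto simp: card_cartesian_product)
  qed
  have "patterns A k \<subseteq> repeat_free A n k \<union> (\<Union>z\<in>Q. ?F z)"
    by (auto simp: repeat_free_def inj_on_def Q_def)
  then have "card (patterns A k :: (int ^ 'd \<Rightarrow> 'a) set)
      \<le> card (repeat_free A n k \<union> (\<Union>z\<in>Q. ?F z))"
    using A Q by (intro card_mono) auto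
  also have "\<dots> \<le> card (repeat_free A n k :: (int ^ 'd \<Rightarrow> 'a) set) + card (\<Union>z\<in>Q. ?F z)"
    by (rule card_Un_le)
  also have "card (\<Union>z\<in>Q. ?F z) \<le> (\<Sum>z\<in>Q. card (?F z))"
    using Q by (intro card_UN_le)
  also have "\<dots> \<le> (\<Sum>z\<in>Q. card A ^ (k ^ CARD('d) - n ^ CARD('d)))"
    using card_equal_torus_windows[OF A n] by (intro sum_mono) (auto simp: Q_def)
  also have "\<dots> \<le> k ^ CARD('d) * k ^ CARD('d) * card A ^ (k ^ CARD('d) - n ^ CARD('d))"
    using Q by simp
  finally have "2 * card A ^ (k ^ CARD('d)) \<le> 2 * card (repeat_free A n k :: (int ^ 'd \<Rightarrow> 'a) set)
      + 2 * (k ^ CARD('d) * k ^ CARD('d)) * card A ^ (k ^ CARD('d) - n ^ CARD('d))"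
    by simp
  also have "2 * (k ^ CARD('d) * k ^ CARD('d)) * card A ^ (k ^ CARD('d) - n ^ CARD('d))
      \<le> card A ^ (n ^ CARD('d)) * card A ^ (k ^ CARD('d) - n ^ CARD('d))"
    using large by (rule mult_right_mono) simp
  also have "\<dots> = card A ^ (k ^ CARD('d))"
    using n by (simp add: power_mono flip: power_add)
  finally show ?thesis by linarith
qed

text \<open>Once \<open>u\<close> is fixed, the letters of \<open>v\<close> covered by windows shared with \<open>u\<close> are copied
  from \<open>u\<close>. Here no cyclic dependencies arise, in spite of the torus.\<close>
lemma overlapping_pairs_bound:
  fixes A :: "'a set" and \<alpha> :: real and u :: "int ^ 'd::finite \<Rightarrow> 'a"
  assumes A: "finite A" and \<alpha>: "0 < \<alpha>" "\<alpha> \<le> 1" "1 \<le> \<alpha> * card A" and n: "n > 0" "n \<le> k"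
    and u: "u \<in> repeat_free A n k"
  shows "(\<Sum>v | v \<in> repeat_free A n k \<and> torus_windows n k u \<inter> torus_windows n k v \<noteq> {}.
      \<alpha> ^ card (torus_windows n k u \<union> torus_windows n k v))
    \<le> real (encodings CARD('d) n k) *
      (\<alpha> ^ (k ^ CARD('d)) * (\<alpha> * card A) ^ (k ^ CARD('d) - n ^ CARD('d)))"
proof -
  define N where "N = k ^ CARD('d)"
  define Q where "Q = (cube k :: (int ^ 'd) set) \<times> (cube k :: (int ^ 'd) set)"
  define c where "c = 2 * ((k div n + 1) * (k + 1) ^ (CARD('d) - 1))"
  \<comment> \<open>Omitting the empty set is the source of the gain: a nonempty \<open>G\<close>
    covers a whole window and thus at least n^d cells of the torus.\<close>
  define \<G> where "\<G> = {G. G \<subseteq> Q \<and> card G \<le> c} - {{}}"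
  define U where "U G = (\<Union>p\<in>fst ` G. res k ` (+) p ` (cube n :: (int ^ 'd) set))"
    for G :: "((int ^ 'd) \<times> (int ^ 'd)) set"
  define F where "F G = {v \<in> patterns A k. \<forall>(p, q) \<in> G.
      window n (periodize k v) p = window n (periodize k u) q}"
    for G :: "((int ^ 'd) \<times> (int ^ 'd)) set"
  have k: "k > 0" using n by simp
  have Q: "finite Q" "card Q = N * N" by (simp_all add: Q_def N_def card_cartesian_product)
  have fin\<G>: "finite {G. G \<subseteq> Q \<and> card G \<le> c}" by (rule card_subsets_le[OF Q(1)])
  have c\<G>: "card \<G> \<le> encodings CARD('d) n k"
  proof -
    have "card \<G> \<le> card {G. G \<subseteq> Q \<and> card G \<le> c}"
      unfolding \<G>_def using fin\<G> by (intro card_mono) auto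
    also have "\<dots> \<le> (card Q + 1) ^ c"
      by (rule card_subsets_le[OF Q(1)])
    also have "\<dots> \<le> encodings CARD('d) n k"
      unfolding encodings_def c_def Q(2) N_def by (intro power_mono add_mono mult_mono) auto
    finally show ?thesis .
  qed
  have UN: "U G \<subseteq> cube k" for G
    using k by (auto simp: U_def)
  have cUN: "card (U G) \<le> N" for G
    using card_mono[OF finite_cube UN] by (simp add: N_def)
  have nU: "n ^ CARD('d) \<le> card (U G)" if G: "G \<in> \<G>" for G
  proof -
    obtain p where p: "p \<in> fst ` G" using G by (auto simp: \<G>_def)
    have "card ((\<lambda>s. res k (p + s)) ` cube n) \<le> card (U G)"
      using p finite_subset[OF UN[of G]] by (intro card_mono) (auto simp: U_def)
    then show ?thesis by (simp add: card_image[OF inj_on_res[OF n(2)]])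
  qed
  have "(\<Sum>v | v \<in> repeat_free A n k \<and> torus_windows n k u \<inter> torus_windows n k v \<noteq> {}.
      \<alpha> ^ card (torus_windows n k u \<union> torus_windows n k v))
    \<le> real (card \<G>) * (\<alpha> ^ N * (\<alpha> * card A) ^ (N - n ^ CARD('d)))"
  proof (rule sum_le_card_cover[where F = F and b = "\<lambda>G. \<alpha> ^ (2 * N - card (U G))"])
    show "finite {v \<in> repeat_free A n k. torus_windows n k u \<inter> torus_windows n k v \<noteq> {}}"
      using A by simp
    show "finite \<G>" unfolding \<G>_def using fin\<G> by simp
  next
    fix v assume "v \<in> {v \<in> repeat_free A n k. torus_windows n k u \<inter> torus_windows n k v \<noteq> {}}"
    then have v: "v \<in> repeat_free A n k" "torus_windows n k u \<inter> torus_windows n k v \<noteq> {}" by auto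
    define R where "R = {p \<in> cube k. window n (periodize k v) p \<in> torus_windows n k u}"
    have R_ne: "R \<noteq> {}" using v(2) by (auto simp: R_def torus_windows_def[of n k v])
    have RQ: "R \<subseteq> cube k" by (auto simp: R_def)
    have finR: "finite R" using RQ finite_subset finite_cube by blast
    \<comment> \<open>The range [0,k] of the covering lemma admits the torus positions as well. The
      subcover is chosen in the lattice, without identifications, and only then projected by
      \<open>res\<close>.\<close>
    have "cube k \<subseteq> {p :: int ^ 'd. \<forall>i. 0 \<le> p $ i \<and> p $ i \<le> int k}"
      unfolding cube_def by (auto intro: order_trans[of 0 1])
    with RQ have "R \<subseteq> {p. \<forall>i. 0 \<le> p $ i \<and> p $ i \<le> int k}" by simp
    then obtain R' where R': "R' \<subseteq> R" "(\<Union>p\<in>R'. (+) p ` cube n) = (\<Union>p\<in>R. (+) p ` cube n)" "card R' \<le> c"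
      unfolding c_def by (rule translates_subcover[OF _ n(1)])
    have "\<forall>p\<in>R. \<exists>q. q\<in>cube k \<and> window n (periodize k v) p = window n (periodize k u) q"
      by (auto simp: R_def torus_windows_def)
    then obtain f where f: "\<And>p. p \<in> R \<Longrightarrow> f p \<in> cube k \<and> window n (periodize k v) p = window n (periodize k u) (f p)"
      by metis
    define G where "G = (\<lambda>p. (p, f p)) ` R'"
    have "card G \<le> card R'"
      unfolding G_def by (intro card_image_le) (rule finite_subset[OF R'(1) finR])
    then have "card G \<le> c" using R'(3) by simp
    moreover have "R' \<noteq> {}"
      using R'(2) R_ne cube_nonempty[OF n(1), where 'a = 'd] by auto
    ultimately have G: "G \<in> \<G>"
      using f R' RQ by (auto simp: \<G>_def Q_def G_def)
    have "U G = res k ` (\<Union>p\<in>R'. (+) p ` cube n)"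
      unfolding U_def G_def by auto
    then have UG: "U G = res k ` (\<Union>p\<in>R. (+) p ` cube n)"
      by (simp only: R'(2))
    have "card R \<le> card (U G)"
    proof (rule card_inj_on_le[of "\<lambda>p. res k (p + 1)"])
      have "inj_on (\<lambda>p. res k (1 + p)) (cube k)" by (rule inj_on_res) simp
      then show "inj_on (\<lambda>p. res k (p + 1)) R"
        using RQ inj_on_subset by (auto simp: add.commute)
      show "(\<lambda>p. res k (p + 1)) ` R \<subseteq> U G"
        unfolding UG using cube_nonempty[OF n(1)] by auto
      show "finite (U G)" using UN finite_subset finite_cube by blast
    qed
    moreover have "card (torus_windows n k u \<inter> torus_windows n k v) \<le> card R"
    proof -
      have "torus_windows n k u \<inter> torus_windows n k v \<subseteq> window n (periodize k v) ` R"
        by (auto simp: R_def torus_windows_def[of n k v])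
      then show ?thesis using finR surj_card_le by blast
    qed
    moreover have "card (torus_windows n k u) + card (torus_windows n k v)
       = card (torus_windows n k u \<union> torus_windows n k v) + card (torus_windows n k u \<inter> torus_windows n k v)"
      by (rule card_Un_Int) simp_all
    ultimately have "2 * N - card (U G) \<le> card (torus_windows n k u \<union> torus_windows n k v)"
      using card_torus_windows[OF u] card_torus_windows[OF v(1)] by (simp add: N_def)
    then have "\<alpha> ^ card (torus_windows n k u \<union> torus_windows n k v) \<le> \<alpha> ^ (2 * N - card (U G))"
      using \<alpha> by (intro power_decreasing) auto
    moreover have "v \<in> F G"
      using v f R' by (auto simp: F_def G_def repeat_free_def)
    ultimately show "\<exists>G\<in>\<G>. v \<in> F G \<and>
        \<alpha> ^ card (torus_windows n k u \<union> torus_windows n k v) \<le> \<alpha> ^ (2 * N - card (U G))"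
      using G by auto
  next
    fix G assume G: "G \<in> \<G>"
    show "0 \<le> \<alpha> ^ (2 * N - card (U G))" using \<alpha> by simp
    show "finite (F G)" using A by (simp add: F_def)
    have "card (F G) \<le> card A ^ (card (cube k :: (int ^ 'd) set) - card (U G))"
    proof (rule card_determined_le[OF A finite_cube UN])
      show "F G \<subseteq> cube k \<rightarrow>\<^sub>E A" by (auto simp: F_def patterns_def)
    next
      fix v w assume v: "v \<in> F G" and w: "w \<in> F G" and eq: "\<And>s. s \<in> cube k - U G \<Longrightarrow> v s = w s"
      have "v z = w z" if z: "z \<in> cube k" for z
      proof (cases "z \<in> U G")
        case True
        then obtain p q s where s: "(p, q) \<in> G" "s \<in> cube n" "z = res k (p + s)"
          by (auto simp: U_def)
        have "periodize k v (p + s) = periodize k u (q + s)" "periodize k w (p + s) = periodize k u (q + s)"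
          using v w s by (auto simp: F_def intro!: window_eqD)
        then show ?thesis by (simp add: s(3) periodize_def)
      next
        case False
        then show ?thesis using eq z by auto
      qed
      then show "v = w"
        using v w by (intro PiE_ext[of v "cube k" "\<lambda>_. A" w]) (auto simp: F_def patterns_def)
    qed
    then have cF: "real (card (F G)) \<le> real (card A) ^ (N - card (U G))"
      unfolding N_def card_cube by (metis of_nat_mono of_nat_power)
    \<comment> \<open>In contrast to the first moment no truncation occurs: the torus has as many
      cells as window positions, and \<open>U G\<close> lies inside it.\<close>
    have "2 * N - card (U G) = N + (N - card (U G))"
      using cUN[of G] by simp
    then have "real (card (F G)) * \<alpha> ^ (2 * N - card (U G))
        \<le> real (card A) ^ (N - card (U G)) * \<alpha> ^ (N + (N - card (U G)))"
      using \<alpha> cF by (auto intro: mult_right_mono)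
    also have "real (card A) ^ (N - card (U G)) * \<alpha> ^ (N + (N - card (U G)))
        = \<alpha> ^ N * (\<alpha> * card A) ^ (N - card (U G))"
      by (simp add: power_add power_mult_distrib)
    also have "\<dots> \<le> \<alpha> ^ N * (\<alpha> * card A) ^ (N - n ^ CARD('d))"
      using \<alpha> nU[OF G] by (intro mult_left_mono power_increasing) auto
    finally show "real (card (F G)) * \<alpha> ^ (2 * N - card (U G))
        \<le> \<alpha> ^ N * (\<alpha> * card A) ^ (N - n ^ CARD('d))" .
  qed
  also have "\<dots> \<le> real (encodings CARD('d) n k) * (\<alpha> ^ N * (\<alpha> * card A) ^ (N - n ^ CARD('d)))"
    using c\<G> \<alpha> by (intro mult_right_mono) auto
  finally show ?thesis unfolding N_def .
qed

section \<open>Periodic entropy\<close>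

lemma shift_shift: "shift p (shift a x) = shift (a + p) x"
  by (simp add: shift_def add.assoc)

lemma shift_in_sft: "x \<in> sft A n \<omega> \<Longrightarrow> shift a x \<in> sft A n \<omega>"
  unfolding sft_def mem_Collect_eq shift_shift by (auto simp: shift_def)

text \<open>A shift vector matters only modulo \<open>N\<close>, so the orbit is the image of the
  finite set \<open>cube N\<close>.\<close>

lemma periodic_pointI:
  assumes x: "x \<in> sft A n \<omega>" and per: "periodize N x = x" and N: "N > 0"
  shows "x \<in> periodic_points (sft A n \<omega>)"
proof -
  define \<gamma> where "\<gamma> = range (\<lambda>p. shift p x)"
  have "shift (res N p) x = shift p x" for p
    unfolding shift_def using periodize_res[of N x p] unfolding per by (rule ext)
  then have "shift p x \<in> (\<lambda>p. shift p x) ` cube N" for p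
    using res_in_cube[OF N, of p] by (intro image_eqI[of _ _ "res N p"]) simp_all
  then have "\<gamma> \<subseteq> (\<lambda>p. shift p x) ` cube N" unfolding \<gamma>_def by blast
  then have fin: "finite \<gamma>" by (rule finite_subset) simp
  have sub: "\<gamma> \<subseteq> sft A n \<omega>" using shift_in_sft[OF x] by (auto simp: \<gamma>_def)
  have x\<gamma>: "x \<in> \<gamma>" unfolding \<gamma>_def by (rule range_eqI[of _ _ 0]) (simp add: shift_def)
  have orb: "{shift p y | p. True} = \<gamma>" if "y \<in> \<gamma>" for y
  proof (intro equalityI subsetI)
    obtain a where y: "y = shift a x" using \<open>y \<in> \<gamma>\<close> by (auto simp: \<gamma>_def)
    fix z
    show "z \<in> \<gamma>" if "z \<in> {shift p y | p. True}"
      using that unfolding y shift_shift \<gamma>_def by blast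
    show "z \<in> {shift p y | p. True}" if z: "z \<in> \<gamma>"
    proof -
      obtain q where "z = shift q x" using z by (auto simp: \<gamma>_def)
      then have "z = shift (q - a) y" by (simp add: y shift_shift)
      then show ?thesis by blast
    qed
  qed
  have "finite_orbit (sft A n \<omega>) \<gamma>"
    unfolding finite_orbit_def by (intro conjI ballI fin sub orb) (use x\<gamma> in auto)
  then show ?thesis
    using x x\<gamma> unfolding periodic_points_def by blast
qed

lemma periodic_language_subset:
  "{restrict x (cube k) | x. x \<in> periodic_points (sft A n \<omega>)} \<subseteq> patterns A k"
  by (auto simp: periodic_points_def sft_def patterns_def)

text \<open>The logarithm of a natural number is nonnegative, with \<open>ln 0 = 0\<close> included.
  This alone gives the lower bound when \<alpha> |A| \<le> 1.\<close>

lemma periodic_entropy_nonneg: "0 \<le> periodic_entropy X"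
proof -
  have "0 \<le> ln (real c)" for c by (cases c) simp_all
  then show ?thesis
    unfolding periodic_entropy_def by (intro le_Limsup always_eventually allI) simp_all
qed

section \<open>Decomposition of the lattice into blocks of side k\<close>

definition blk :: "nat \<Rightarrow> int ^ 'd \<Rightarrow> int ^ 'd" where
  "blk k q = (\<chi> i. (q $ i - 1) div int k + 1)"

definition blk_offset :: "nat \<Rightarrow> int ^ 'd \<Rightarrow> int ^ 'd" where
  "blk_offset k j = (\<chi> i. (j $ i - 1) * int k)"

lemma blk_offset_add_res: "blk_offset k (blk k q) + res k q = q"
  by (simp add: vec_eq_iff blk_offset_def blk_def res_def div_mult_mod_eq)

lemma blk_res_blk_offset_add:
  assumes "s \<in> cube k"
  shows "blk k (blk_offset k j + s) = j" "res k (blk_offset k j + s) = s"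
proof -
  have s: "1 \<le> s $ i" "s $ i \<le> int k" for i using assms by (simp_all add: cube_def)
  have "((j $ i - 1) * int k + s $ i - 1) div int k = j $ i - 1" for i
    by (rule int_div_pos_eq[where r = "s $ i - 1"]) (use s[of i] in \<open>auto simp: mult.commute\<close>)
  then show "blk k (blk_offset k j + s) = j" by (simp add: vec_eq_iff blk_def blk_offset_def)
  have "((j $ i - 1) * int k + s $ i - 1) mod int k = s $ i - 1" for i
    by (rule int_mod_pos_eq[where q = "j $ i - 1"]) (use s[of i] in \<open>auto simp: mult.commute\<close>)
  then show "res k (blk_offset k j + s) = s" by (simp add: vec_eq_iff res_def blk_offset_def)
qed

lemma blk_in_cube:
  assumes "q \<in> cube K" "k > 0" "K \<le> J * k"
  shows "blk k q \<in> cube J"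
proof -
  have "1 \<le> blk k q $ i \<and> blk k q $ i \<le> int J" for i
  proof -
    have q: "1 \<le> q $ i" "q $ i \<le> int K" using assms(1) by (simp_all add: cube_def)
    then have "q $ i - 1 < int J * int k"
    proof -
      have "int K \<le> int J * int k" using of_nat_mono[OF assms(3)] by simp
      then show ?thesis using q by linarith
    qed
    moreover have "(q $ i - 1) div int k * int k \<le> q $ i - 1"
      using div_mult_mod_eq[of "q $ i - 1" "int k"] pos_mod_sign[of "int k" "q $ i - 1"] assms(2) by linarith
    ultimately have "(q $ i - 1) div int k * int k < int J * int k" by linarith
    then have "(q $ i - 1) div int k < int J"
      by (rule mult_right_less_imp_less) simp
    moreover have "0 \<le> (q $ i - 1) div int k"
      using q assms(2) by (simp add: pos_imp_zdiv_nonneg_iff)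
    ultimately show ?thesis by (simp add: blk_def)
  qed
  then show ?thesis by (simp add: cube_def)
qed

lemma blk_offset_add_in_cube:
  assumes "j \<in> cube J" "s \<in> cube k"
  shows "blk_offset k j + s \<in> cube (J * k)"
proof -
  have "1 \<le> (j $ i - 1) * int k + s $ i \<and> (j $ i - 1) * int k + s $ i \<le> int J * int k" for i
  proof -
    have b: "1 \<le> j $ i" "j $ i \<le> int J" "1 \<le> s $ i" "s $ i \<le> int k"
      using assms by (simp_all add: cube_def)
    have "0 \<le> (j $ i - 1) * int k" "(j $ i - 1) * int k \<le> (int J - 1) * int k"
      using b by (auto intro: mult_right_mono)
    moreover have "int J * int k = (int J - 1) * int k + int k" by (simp add: algebra_simps)
    ultimately show ?thesis using b by linarith
  qed
  then show ?thesis by (simp add: cube_def blk_offset_def)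
qed

section \<open>Upper bound for the periodic entropy by locally admissible patterns\<close>

definition legal_patterns :: "'a set \<Rightarrow> nat \<Rightarrow> nat \<Rightarrow> (int ^ 'd \<Rightarrow> 'a) set \<Rightarrow> (int ^ 'd \<Rightarrow> 'a) set" where
  "legal_patterns A n k \<omega> = {u \<in> patterns A k. window n u ` offsets k n \<subseteq> \<omega>}"

lemma restrict_shift_legal:
  assumes x: "x \<in> sft A n \<omega>" and nk: "n \<le> k"
  shows "restrict (shift a x) (cube k) \<in> legal_patterns A n k \<omega>"
proof -
  have "window n (restrict (shift a x) (cube k)) p \<in> \<omega>" if p: "p \<in> offsets k n" for p
  proof -
    have "window n (restrict (shift a x) (cube k)) p = window n x (a + p)"
      using offsets_add_cube[OF nk p] by (intro window_eqI) (simp add: shift_def add.assoc)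
    then show ?thesis using x by (simp add: sft_def window_def)
  qed
  then show ?thesis using x by (auto simp: legal_patterns_def patterns_def sft_def shift_def)
qed

text \<open>A cube of side \<open>K\<close> is covered by J^d blocks of side \<open>k\<close>, each
  carrying a legal pattern. Conditions on windows across block borders are dropped, which can only
  enlarge the count; \<open>dec\<close> reassembles the blocks.\<close>

lemma card_periodic_language_le:
  fixes \<omega> :: "(int ^ 'd::finite \<Rightarrow> 'a) set"
  assumes A: "finite A" and k: "k > 0" "n \<le> k" and J: "K \<le> J * k"
  shows "card {restrict x (cube K) | x. x \<in> periodic_points (sft A n \<omega>)}
    \<le> card (legal_patterns A n k \<omega>) ^ (J ^ CARD('d))"
proof -
  define dec where "dec a = restrict (\<lambda>q. a (blk k q) (res k q)) (cube K)"
    for a :: "int ^ 'd \<Rightarrow> int ^ 'd \<Rightarrow> 'a"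
  define T where "T = ((cube J :: (int ^ 'd) set) \<rightarrow>\<^sub>E legal_patterns A n k \<omega>)"
  have fin: "finite (legal_patterns A n k \<omega>)" using A by (simp add: legal_patterns_def)
  have "{restrict x (cube K) | x. x \<in> periodic_points (sft A n \<omega>)} \<subseteq> dec ` T"
  proof
    fix w assume "w \<in> {restrict x (cube K) | x. x \<in> periodic_points (sft A n \<omega>)}"
    then obtain x where x: "x \<in> sft A n \<omega>" "w = restrict x (cube K)"
      by (auto simp: periodic_points_def)
    define a where "a = restrict (\<lambda>j. restrict (shift (blk_offset k j) x) (cube k)) (cube J :: (int ^ 'd) set)"
    have "a \<in> T" unfolding a_def T_def using restrict_shift_legal[OF x(1) k(2)] by auto
    moreover have "w = dec a"
      using blk_in_cube[OF _ k(1) J] res_in_cube[OF k(1)]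
      by (auto simp: dec_def a_def x(2) shift_def blk_offset_add_res fun_eq_iff)
    ultimately show "w \<in> dec ` T" by blast
  qed
  then have "card {restrict x (cube K) | x. x \<in> periodic_points (sft A n \<omega>)} \<le> card T"
    using fin by (intro surj_card_le) (auto simp: T_def intro!: finite_PiE)
  also have "card T = card (legal_patterns A n k \<omega>) ^ (J ^ CARD('d))"
    unfolding T_def by (subst card_PiE) simp_all
  finally show ?thesis .
qed

text \<open>The \<open>K div k + 1\<close> blocks per direction, rounded up, amount to K/k
  asymptotically. Legal patterns need not extend to points of the shift; being defined by finitely
  many windows, they are accessible to a first moment computation.\<close>

lemma periodic_entropy_le:
  fixes \<omega> :: "(int ^ 'd::finite \<Rightarrow> 'a) set"
  assumes A: "finite A" and k: "k > 0" "n \<le> k"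
  shows "periodic_entropy (sft A n \<omega>)
    \<le> ereal (ln (real (card (legal_patterns A n k \<omega>))) / real k ^ CARD('d))"
proof -
  define l where "l = ln (real (card (legal_patterns A n k \<omega>)))"
  define b where "b K = ((real K / real k + 1) / real K) ^ CARD('d) * l" for K
  have l: "0 \<le> l" unfolding l_def by (cases "card (legal_patterns A n k \<omega>)") simp_all
  have "periodic_entropy (sft A n \<omega>) \<le> limsup (\<lambda>K. ereal (b K))"
    unfolding periodic_entropy_def
  proof (rule Limsup_mono, rule eventually_mono[OF eventually_gt_at_top[of 0]])
    fix K :: nat assume K: "0 < K"
    define c where "c = card {restrict x (cube K) | x. x \<in> periodic_points (sft A n \<omega>)}"
    define J where "J = K div k + 1"
    have "K \<le> J * k"
      unfolding J_def using k(1) by (simp add: dividend_less_div_times less_imp_le add.commute)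
    then have c: "c \<le> card (legal_patterns A n k \<omega>) ^ (J ^ CARD('d))"
      unfolding c_def by (rule card_periodic_language_le[OF A k])
    have "ln (real c) \<le> real (J ^ CARD('d)) * l"
    proof (cases "c = 0")
      case False
      then have "card (legal_patterns A n k \<omega>) > 0"
        using c by (cases "card (legal_patterns A n k \<omega>)") (auto simp: J_def power_0_left)
      moreover have "real c \<le> real (card (legal_patterns A n k \<omega>)) ^ (J ^ CARD('d))"
        using c by (metis of_nat_mono of_nat_power)
      then have "ln (real c) \<le> ln (real (card (legal_patterns A n k \<omega>)) ^ (J ^ CARD('d)))"
        using False by (intro ln_mono) simp_all
      ultimately show ?thesis by (simp add: ln_realpow l_def)
    qed (use l in simp)
    also have "real (J ^ CARD('d)) \<le> (real K / real k + 1) ^ CARD('d)"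
      unfolding J_def of_nat_power by (intro power_mono) (auto simp: of_nat_div_le_of_nat)
    finally have "ln (real c) \<le> (real K / real k + 1) ^ CARD('d) * l"
      using l by (simp add: mult_right_mono)
    then have "1 / real K ^ CARD('d) * ln (real c)
        \<le> 1 / real K ^ CARD('d) * ((real K / real k + 1) ^ CARD('d) * l)"
      by (intro mult_left_mono) auto
    also have "\<dots> = b K" unfolding b_def power_divide by simp
    finally show "ereal (1 / real K ^ CARD('d) *
        ln (real (card {restrict x (cube K) | x. x \<in> periodic_points (sft A n \<omega>)}))) \<le> ereal (b K)"
      by (simp add: c_def)
  qed
  also have "limsup (\<lambda>K. ereal (b K)) = ereal (l / real k ^ CARD('d))"
  proof (rule lim_imp_Limsup)
    have "(\<lambda>K. (real K / real k + 1) / real K) \<longlonglongrightarrow> 1 / real k"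
      using k(1) by (real_asymp simp: inverse_eq_divide)
    then have "b \<longlonglongrightarrow> (1 / real k) ^ CARD('d) * l"
      unfolding b_def by (intro tendsto_mult tendsto_power tendsto_const)
    then show "(\<lambda>K. ereal (b K)) \<longlonglongrightarrow> ereal (l / real k ^ CARD('d))"
      by (simp add: power_divide)
  qed simp
  finally show ?thesis unfolding l_def .
qed

section \<open>Lower bound for the periodic entropy by gluing blocks\<close>

lemma mod_less_if_div_neq:
  fixes p \<sigma> k :: int
  assumes "0 \<le> \<sigma>" "\<sigma> < k" "(p + \<sigma>) div k \<noteq> p div k"
  shows "(p + \<sigma>) mod k < \<sigma>"
proof -
  have r: "0 \<le> p mod k" "p mod k < k" using assms by simp_all
  have p: "p = k * (p div k) + p mod k" by simp
  have "p mod k + \<sigma> \<ge> k"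
  proof (rule ccontr)
    assume "\<not> p mod k + \<sigma> \<ge> k"
    then have "(p + \<sigma>) div k = p div k"
      using r assms p by (intro int_div_pos_eq[where r = "p mod k + \<sigma>"]) auto
    then show False using assms by simp
  qed
  then have b: "0 \<le> p mod k + \<sigma> - k" "p mod k + \<sigma> - k < k"
    using r assms by linarith+
  have "p + \<sigma> = k * (p div k + 1) + (p mod k + \<sigma> - k)"
    using p by (simp add: algebra_simps)
  from int_mod_pos_eq[OF this b] have "(p + \<sigma>) mod k = p mod k + \<sigma> - k" .
  then show ?thesis using r by simp
qed

definition glue :: "nat \<Rightarrow> nat \<Rightarrow> (int ^ 'd \<Rightarrow> int ^ 'd \<Rightarrow> 'a) \<Rightarrow> int ^ 'd \<Rightarrow> 'a" where
  "glue k J a q = a (res J (blk k q)) (res k q)"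

lemma periodize_glue:
  fixes a :: "int ^ 'd::finite \<Rightarrow> int ^ 'd \<Rightarrow> 'a"
  assumes "k > 0" "J > 0"
  shows "periodize (J * k) (glue k J a) = glue k J a"
proof -
  have m: "z mod (int J * int k) = int k * (z div int k mod int J) + z mod int k" for z :: int
    using zmod_zmult2_eq[of "int J" z "int k"] by (simp add: mult.commute)
  have "(z mod (int J * int k)) div int k mod int J = z div int k mod int J"
    "(z mod (int J * int k)) mod int k = z mod int k" for z :: int
    unfolding m using assms by simp_all
  then have "res J (blk k (res (J * k) q)) = res J (blk k q)" "res k (res (J * k) q) = res k q" for q :: "int ^ 'd"
    by (simp_all add: vec_eq_iff res_def blk_def)
  then show ?thesis by (simp add: periodize_def glue_def fun_eq_iff)
qed

text \<open>A window of side \<open>n\<close> that meets several blocks sees only the frame, where all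
  members of \<open>S\<close> agree, outside of the block containing its lower corner.\<close>
lemma glue_in_sft:
  fixes \<omega> :: "(int ^ 'd::finite \<Rightarrow> 'a) set"
  assumes n: "n \<le> k" "k > 0" and J: "J > 0"
    and sft: "\<And>u. u \<in> S \<Longrightarrow> periodize k u \<in> sft A n \<omega>"
    and frame: "\<And>u v s. u \<in> S \<Longrightarrow> v \<in> S \<Longrightarrow> s \<in> cube k \<Longrightarrow> \<exists>i. s $ i \<le> int n \<Longrightarrow> u s = v s"
    and a: "\<And>j. j \<in> cube J \<Longrightarrow> a j \<in> S"
  shows "glue k J a \<in> sft A n \<omega>"
proof -
  have aS: "a (res J q) \<in> S" for q by (intro a res_in_cube J)
  have "glue k J a q \<in> A" for q
    using sft[OF aS[of "blk k q"]] by (auto simp: sft_def periodize_def glue_def)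
  moreover have "window n (glue k J a) p \<in> \<omega>" for p
  proof -
    define u where "u = a (res J (blk k (p + 1)))"
    have uS: "u \<in> S" unfolding u_def by (rule aS)
    have "window n (glue k J a) p = window n (periodize k u) p"
    proof (rule window_eqI)
      fix s :: "int ^ 'd" assume s: "s \<in> cube n"
      show "glue k J a (p + s) = periodize k u (p + s)"
      proof (cases "blk k (p + s) = blk k (p + 1)")
        case True
        then show ?thesis by (simp add: glue_def periodize_def u_def)
      next
        case False
        then obtain i where i: "(p $ i + (s $ i - 1)) div int k \<noteq> p $ i div int k"
          by (auto simp: blk_def vec_eq_iff add_diff_eq)
        have si: "1 \<le> s $ i" "s $ i \<le> int n" using s by (simp_all add: cube_def)
        \<comment> \<open>From the lower corner \<open>p + 1\<close> of the window,
          \<open>s $ i - 1\<close> steps in direction \<open>i\<close> have crossed a block border,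
          so the residue is smaller than the number of steps. The cell lies in the frame along the
          lower face of its block.\<close>
        have "(p $ i + (s $ i - 1)) mod int k < s $ i - 1"
          using si n i by (intro mod_less_if_div_neq) auto
        then have "res k (p + s) $ i \<le> int n"
          using si by (simp add: res_def algebra_simps)
        then show ?thesis
          unfolding glue_def periodize_def using res_in_cube[OF n(2), of "p + s"]
          by (intro frame[OF aS uS]) auto
      qed
    qed
    then show ?thesis using sft[OF uS] by (simp add: sft_def window_def)
  qed
  ultimately show ?thesis by (simp add: sft_def window_def)
qed

text \<open>The blocks of a glued point are chosen independently and can be read off on the cube of
  side \<open>J * k\<close>, which yields |S|^(J^d) periodic patterns. The entropy being a limsup,
  sides that are multiples of \<open>k\<close> suffice. The frame consists of lower faces only,
  because a window is compared with the block at its lower corner.\<close>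

lemma periodic_entropy_ge:
  fixes \<omega> :: "(int ^ 'd::finite \<Rightarrow> 'a) set"
  assumes A: "finite A" and n: "n \<le> k" "k > 0" and S: "S \<subseteq> patterns A k" "S \<noteq> {}"
    and sft: "\<And>u. u \<in> S \<Longrightarrow> periodize k u \<in> sft A n \<omega>"
    and frame: "\<And>u v s. u \<in> S \<Longrightarrow> v \<in> S \<Longrightarrow> s \<in> cube k \<Longrightarrow> \<exists>i. s $ i \<le> int n \<Longrightarrow> u s = v s"
  shows "ereal (ln (real (card S)) / real k ^ CARD('d)) \<le> periodic_entropy (sft A n \<omega>)"
proof -
  define X where "X K = ereal (1 / real K ^ CARD('d) *
    ln (real (card {restrict x (cube K) | x. x \<in> periodic_points (sft A n \<omega>)})))" for K
  have finS: "finite S" using S(1) A finite_subset finite_patterns by blast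
  then have cS: "card S > 0" using S(2) by (simp add: card_gt_0_iff)
  have main: "ereal (ln (real (card S)) / real k ^ CARD('d)) \<le> X (J * k)" if J: "J > 0" for J
  proof -
    define T where "T = ((cube J :: (int ^ 'd) set) \<rightarrow>\<^sub>E S)"
    define \<L> where "\<L> = {restrict x (cube (J * k)) | x. x \<in> periodic_points (sft A n \<omega>)}"
    have "card T \<le> card \<L>"
    proof (rule card_inj_on_le[of "\<lambda>a. restrict (glue k J a) (cube (J * k))"])
      show "inj_on (\<lambda>a. restrict (glue k J a) (cube (J * k))) T"
      proof (rule inj_onI)
        fix a b assume ab: "a \<in> T" "b \<in> T"
          and eq: "restrict (glue k J a) (cube (J * k)) = restrict (glue k J b) (cube (J * k))"
        have "a j = b j" if j: "j \<in> cube J" for j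
        proof -
          have "a j s = b j s" if s: "s \<in> cube k" for s
            using fun_cong[OF eq, of "blk_offset k j + s"] blk_offset_add_in_cube[OF j s]
            by (simp add: glue_def blk_res_blk_offset_add[OF s] res_id[OF j])
          moreover have "a j \<in> patterns A k" "b j \<in> patterns A k"
            using ab j S(1) by (auto simp: T_def)
          ultimately show ?thesis
            by (intro PiE_ext[of "a j" "cube k" "\<lambda>_. A" "b j"]) (auto simp: patterns_def)
        qed
        then show "a = b"
          using ab by (intro PiE_ext[of a "cube J" "\<lambda>_. S" b]) (auto simp: T_def)
      qed
      show "(\<lambda>a. restrict (glue k J a) (cube (J * k))) ` T \<subseteq> \<L>"
      proof
        fix w assume "w \<in> (\<lambda>a. restrict (glue k J a) (cube (J * k))) ` T"
        then obtain a where a: "a \<in> T" "w = restrict (glue k J a) (cube (J * k))" by auto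
        have "glue k J a \<in> sft A n \<omega>"
        proof (rule glue_in_sft[where S = S, OF n J])
          show "a j \<in> S" if "j \<in> cube J" for j using a(1) that by (auto simp: T_def)
        qed (fact sft, fact frame)
        then have "glue k J a \<in> periodic_points (sft A n \<omega>)"
          using n J by (intro periodic_pointI[of _ _ _ _ "J * k"] periodize_glue) auto
        then show "w \<in> \<L>" using a(2) by (auto simp: \<L>_def)
      qed
      show "finite \<L>"
        unfolding \<L>_def using A by (intro finite_subset[OF periodic_language_subset]) simp
    qed
    also have "card T = card S ^ (J ^ CARD('d))"
      unfolding T_def by (subst card_PiE) simp_all
    finally have "real (card S) ^ (J ^ CARD('d)) \<le> real (card \<L>)"
      by (metis of_nat_mono of_nat_power)
    then have "ln (real (card S) ^ (J ^ CARD('d))) \<le> ln (real (card \<L>))"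
      using cS by (intro ln_mono) simp_all
    then have "real J ^ CARD('d) * ln (real (card S)) \<le> ln (real (card \<L>))"
      using cS by (simp add: ln_realpow)
    then have "1 / real (J * k) ^ CARD('d) * (real J ^ CARD('d) * ln (real (card S)))
        \<le> 1 / real (J * k) ^ CARD('d) * ln (real (card \<L>))"
      by (intro mult_left_mono) auto
    then show ?thesis
      using J n by (simp add: X_def \<L>_def power_mult_distrib)
  qed
  have "ereal (ln (real (card S)) / real k ^ CARD('d)) \<le> limsup (X \<circ> (\<lambda>J. Suc J * k))"
    by (intro le_Limsup always_eventually allI) (simp_all only: main comp_def zero_less_Suc sequentially_bot not_False_eq_True)
  also have "\<dots> \<le> limsup X"
    using n by (intro limsup_subseq_mono) (auto simp: strict_mono_def)
  finally show ?thesis unfolding periodic_entropy_def X_def .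
qed

section \<open>Random sets of patterns\<close>

lemma finite_set_random_patterns: "finite A \<Longrightarrow> finite (set_pmf (random_patterns A n \<alpha>))"
  by (rule finite_subset[of _ "Pow (patterns A n)"]) (auto simp: random_patterns_def)

text \<open>The event is a product set in the independent indicators, with a condition only at the
  elements of \<open>W\<close>. So only the number of distinct windows of a pattern enters the
  moments.\<close>

lemma prob_random_patterns_superset:
  fixes W :: "(int ^ 'd::finite \<Rightarrow> 'a) set"
  assumes "finite A" "0 \<le> \<alpha>" "\<alpha> \<le> 1" "W \<subseteq> patterns A n"
  shows "measure_pmf.prob (random_patterns A n \<alpha>) {\<omega>. W \<subseteq> \<omega>} = \<alpha> ^ card W"
proof -
  let ?P = "patterns A n :: (int ^ 'd \<Rightarrow> 'a) set"
  have eq: "(\<lambda>f. {u \<in> ?P. f u}) -` {\<omega>. W \<subseteq> \<omega>} = Pi ?P (\<lambda>w. if w \<in> W then {True} else UNIV)"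
    using assms(4) by (auto simp: Pi_def)
  have "measure_pmf.prob (random_patterns A n \<alpha>) {\<omega>. W \<subseteq> \<omega>}
      = (\<Prod>w\<in>?P. measure_pmf.prob (bernoulli_pmf \<alpha>) (if w \<in> W then {True} else UNIV))"
    unfolding random_patterns_def measure_map_pmf eq
    using assms(1) by (subst measure_Pi_pmf_Pi) simp_all
  also have "\<dots> = (\<Prod>w\<in>?P. if w \<in> W then \<alpha> else 1)"
    using assms by (intro prod.cong) (auto simp: measure_pmf_single)
  also have "\<dots> = \<alpha> ^ card W"
    using assms(1,4) by (simp add: prod.If_cases Int_absorb1 Int_def[symmetric] inf.absorb2)
  finally show ?thesis .
qed

lemma expectation_count:
  assumes "finite (set_pmf p)" "finite \<U>"
  shows "measure_pmf.expectation p (\<lambda>\<omega>. real (card {u \<in> \<U>. E u \<omega>}))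
    = (\<Sum>u\<in>\<U>. measure_pmf.prob p {\<omega>. E u \<omega>})"
proof -
  have "real (card {u \<in> \<U>. E u \<omega>}) = (\<Sum>u\<in>\<U>. indicator {\<omega>. E u \<omega>} \<omega>)" for \<omega>
    using assms(2) by (simp add: indicator_def sum.If_cases Int_def)
  then show ?thesis
    using assms(1) by (simp add: integrable_measure_pmf_finite)
qed

lemma count_markov:
  fixes W :: "'u \<Rightarrow> (int ^ 'd::finite \<Rightarrow> 'a) set"
  assumes A: "finite A" and \<alpha>: "0 \<le> \<alpha>" "\<alpha> \<le> 1"
    and \<U>: "finite \<U>" "\<And>u. u \<in> \<U> \<Longrightarrow> W u \<subseteq> patterns A n" and t: "t > 0"
  shows "measure_pmf.prob (random_patterns A n \<alpha>) {\<omega>. t \<le> real (card {u \<in> \<U>. W u \<subseteq> \<omega>})}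
    \<le> (\<Sum>u\<in>\<U>. \<alpha> ^ card (W u)) / t"
proof -
  let ?p = "random_patterns A n \<alpha>"
  have "measure_pmf.prob ?p {\<omega>. t \<le> real (card {u \<in> \<U>. W u \<subseteq> \<omega>})}
      \<le> measure_pmf.expectation ?p (\<lambda>\<omega>. real (card {u \<in> \<U>. W u \<subseteq> \<omega>})) / t"
    using integral_Markov_inequality_measure[OF
        integrable_measure_pmf_finite[OF finite_set_random_patterns[OF A]],
        of "{}" n \<alpha> "\<lambda>\<omega>. real (card {u \<in> \<U>. W u \<subseteq> \<omega>})" t] t
    by simp
  also have "measure_pmf.expectation ?p (\<lambda>\<omega>. real (card {u \<in> \<U>. W u \<subseteq> \<omega>}))
      = (\<Sum>u\<in>\<U>. \<alpha> ^ card (W u))"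
    unfolding expectation_count[OF finite_set_random_patterns[OF A] \<U>(1)]
    by (intro sum.cong refl prob_random_patterns_superset A \<alpha> \<U>(2))
  finally show ?thesis .
qed

text \<open>The squared count is a count of pairs. Pairs with disjoint window sets have probability
  exactly \<open>\<alpha> ^ N * \<alpha> ^ N\<close> and are absorbed by the squared expectation.
  Only pairs sharing a window remain, and the variance is at most
  \<open>card \<U> * V\<close>.\<close>

lemma count_chebyshev:
  fixes W :: "'u \<Rightarrow> (int ^ 'd::finite \<Rightarrow> 'a) set"
  assumes A: "finite A" and \<alpha>: "0 < \<alpha>" "\<alpha> \<le> 1"
    and \<U>: "finite \<U>" "\<U> \<noteq> {}" "\<And>u. u \<in> \<U> \<Longrightarrow> W u \<subseteq> patterns A n"
    and N: "\<And>u. u \<in> \<U> \<Longrightarrow> card (W u) = N"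
    and V: "\<And>u. u \<in> \<U> \<Longrightarrow>
      (\<Sum>v | v \<in> \<U> \<and> W u \<inter> W v \<noteq> {}. \<alpha> ^ card (W u \<union> W v)) \<le> V"
  shows "measure_pmf.prob (random_patterns A n \<alpha>)
      {\<omega>. real (card {u \<in> \<U>. W u \<subseteq> \<omega>}) \<le> real (card \<U>) * \<alpha> ^ N / 2}
    \<le> 4 * V / (real (card \<U>) * (\<alpha> ^ N * \<alpha> ^ N))"
proof -
  let ?p = "random_patterns A n \<alpha>"
  define X where "X \<omega> = real (card {u \<in> \<U>. W u \<subseteq> \<omega>})" for \<omega>
  define E where "E = real (card \<U>) * \<alpha> ^ N"
  have fin: "finite (set_pmf ?p)" using A by (rule finite_set_random_patterns)
  have int: "integrable (measure_pmf ?p) f" for f :: "_ \<Rightarrow> real"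
    using fin by (rule integrable_measure_pmf_finite)
  have cU: "card \<U> > 0" using \<U> by (simp add: card_gt_0_iff)
  have E: "E > 0" using cU \<alpha> by (simp add: E_def)
  have finW: "finite (W u)" if "u \<in> \<U>" for u
    using \<U>(3)[OF that] A finite_subset finite_patterns by blast
  have "measure_pmf.expectation ?p X = (\<Sum>u\<in>\<U>. \<alpha> ^ card (W u))"
    unfolding X_def expectation_count[OF fin \<U>(1)]
    using \<alpha> by (intro sum.cong refl prob_random_patterns_superset A \<U>(3)) auto
  then have EX: "measure_pmf.expectation ?p X = E"
    by (simp add: E_def N)
  have X2: "(X \<omega>)\<^sup>2 = real (card {z \<in> \<U> \<times> \<U>. W (fst z) \<union> W (snd z) \<subseteq> \<omega>})" for \<omega>
  proof -
    have "{z \<in> \<U> \<times> \<U>. W (fst z) \<union> W (snd z) \<subseteq> \<omega>} = {u \<in> \<U>. W u \<subseteq> \<omega>} \<times> {u \<in> \<U>. W u \<subseteq> \<omega>}"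
      by auto
    then show ?thesis by (simp add: X_def card_cartesian_product power2_eq_square)
  qed
  have "measure_pmf.expectation ?p (\<lambda>\<omega>. (X \<omega>)\<^sup>2)
      = (\<Sum>z\<in>\<U> \<times> \<U>. \<alpha> ^ card (W (fst z) \<union> W (snd z)))"
    unfolding X2 expectation_count[OF fin finite_cartesian_product[OF \<U>(1) \<U>(1)]]
  proof (intro sum.cong refl prob_random_patterns_superset A)
    show "W (fst z) \<union> W (snd z) \<subseteq> patterns A n" if "z \<in> \<U> \<times> \<U>" for z
      using \<U>(3)[of "fst z"] \<U>(3)[of "snd z"] that by auto
  qed (use \<alpha> in auto)
  also have "\<dots> = (\<Sum>(u, v)\<in>\<U> \<times> \<U>. \<alpha> ^ card (W u \<union> W v))"
    by (simp add: case_prod_unfold)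
  also have "\<dots> = (\<Sum>u\<in>\<U>. \<Sum>v\<in>\<U>. \<alpha> ^ card (W u \<union> W v))"
    by (simp add: sum.cartesian_product)
  also have "\<dots> \<le> (\<Sum>u\<in>\<U>. V + real (card \<U>) * (\<alpha> ^ N * \<alpha> ^ N))"
  proof (rule sum_mono)
    fix u assume u: "u \<in> \<U>"
    have "(\<Sum>v\<in>\<U>. \<alpha> ^ card (W u \<union> W v))
        \<le> (\<Sum>v\<in>\<U>. (if W u \<inter> W v \<noteq> {} then \<alpha> ^ card (W u \<union> W v) else 0) + \<alpha> ^ N * \<alpha> ^ N)"
    proof (rule sum_mono)
      fix v assume v: "v \<in> \<U>"
      show "\<alpha> ^ card (W u \<union> W v)
          \<le> (if W u \<inter> W v \<noteq> {} then \<alpha> ^ card (W u \<union> W v) else 0) + \<alpha> ^ N * \<alpha> ^ N"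
        using \<alpha> card_Un_disjoint[of "W u" "W v"] finW[OF u] finW[OF v] N[OF u] N[OF v]
        by (auto simp: power_add)
    qed
    also have "\<dots> = (\<Sum>v | v \<in> \<U> \<and> W u \<inter> W v \<noteq> {}. \<alpha> ^ card (W u \<union> W v))
        + real (card \<U>) * (\<alpha> ^ N * \<alpha> ^ N)"
      using \<U>(1) by (simp add: sum.distrib sum.inter_filter)
    also have "\<dots> \<le> V + real (card \<U>) * (\<alpha> ^ N * \<alpha> ^ N)"
      using V[OF u] by simp
    finally show "(\<Sum>v\<in>\<U>. \<alpha> ^ card (W u \<union> W v)) \<le> V + real (card \<U>) * (\<alpha> ^ N * \<alpha> ^ N)" .
  qed
  also have "\<dots> = real (card \<U>) * V + E\<^sup>2"
    by (simp add: E_def power2_eq_square algebra_simps)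
  finally have var: "measure_pmf.variance ?p X \<le> real (card \<U>) * V"
    using measure_pmf.variance_eq[OF int int, of X] EX by simp
  have "measure_pmf.prob ?p {\<omega>. X \<omega> \<le> E / 2} \<le> measure_pmf.prob ?p {\<omega>. \<bar>X \<omega> - E\<bar> \<ge> E / 2}"
    using E by (intro measure_pmf.finite_measure_mono) (auto simp: abs_if)
  also have "\<dots> \<le> measure_pmf.variance ?p X / (E / 2)\<^sup>2"
  proof -
    have "measure_pmf.prob ?p {\<omega> \<in> space (measure_pmf ?p). E / 2 \<le> \<bar>X \<omega> - measure_pmf.expectation ?p X\<bar>}
        \<le> measure_pmf.variance ?p X / (E / 2)\<^sup>2"
      by (rule measure_pmf.Chebyshev_inequality) (use int E in auto)
    then show ?thesis unfolding EX by simp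
  qed
  also have "\<dots> \<le> real (card \<U>) * V / (E / 2)\<^sup>2"
    using var by (rule divide_right_mono) simp
  also have "\<dots> = 4 * V / (real (card \<U>) * (\<alpha> ^ N * \<alpha> ^ N))"
    using cU by (simp add: E_def power2_eq_square field_simps)
  finally show ?thesis by (simp add: X_def E_def)
qed

section \<open>Tail bounds for given n and k\<close>

lemma window_subset_patterns:
  assumes "u \<in> patterns A k" "n \<le> k"
  shows "window n u ` offsets k n \<subseteq> patterns A n"
  using PiE_mem[OF assms(1)[unfolded patterns_def] offsets_add_cube[OF assms(2)]]
  by (auto simp: window_def shift_def patterns_def[of A n])

text \<open>Entropy at least \<open>h\<close> forces at least exp (h k^d) legal patterns on the box,
  and Markov's inequality compares this with their expected number.\<close>

lemma entropy_upper_tail: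
  fixes A :: "'a set" and \<alpha> h :: real
  assumes A: "finite A" "A \<noteq> {}" and \<alpha>: "0 \<le> \<alpha>" "\<alpha> \<le> 1" and n: "n > 0" "n \<le> k" and h: "h > 0"
  defines "K \<equiv> (k - n + 1) ^ CARD('d)"
  shows "measure_pmf.prob (random_patterns A n \<alpha> :: (int ^ 'd::finite \<Rightarrow> 'a) set pmf)
      {\<omega>. ereal h \<le> periodic_entropy (sft A n \<omega>)}
    \<le> real (encodings CARD('d) n k) *
      (real (card A) ^ (k ^ CARD('d) - K) * max 1 (\<alpha> * card A) ^ K) / exp (h * real k ^ CARD('d))"
proof -
  let ?p = "random_patterns A n \<alpha> :: (int ^ 'd \<Rightarrow> 'a) set pmf"
  let ?W = "\<lambda>u. window n u ` (offsets k n :: (int ^ 'd) set)"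
  have "{\<omega>. ereal h \<le> periodic_entropy (sft A n \<omega>)}
      \<subseteq> {\<omega> :: (int ^ 'd \<Rightarrow> 'a) set. exp (h * real k ^ CARD('d)) \<le> real (card {u \<in> patterns A k. ?W u \<subseteq> \<omega>})}"
  proof
    fix \<omega> :: "(int ^ 'd \<Rightarrow> 'a) set"
    define c where "c = card (legal_patterns A n k \<omega>)"
    assume "\<omega> \<in> {\<omega>. ereal h \<le> periodic_entropy (sft A n \<omega>)}"
    then have "ereal h \<le> periodic_entropy (sft A n \<omega>)" by simp
    also have "periodic_entropy (sft A n \<omega>) \<le> ereal (ln (real c) / real k ^ CARD('d))"
      unfolding c_def using n by (intro periodic_entropy_le A) auto
    finally have "ereal h \<le> ereal (ln (real c) / real k ^ CARD('d))" .
    then have le: "h * real k ^ CARD('d) \<le> ln (real c)"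
      using n by (simp add: pos_le_divide_eq)
    \<comment> \<open>Positivity of \<open>h\<close> excludes \<open>c = 0\<close>, where
      \<open>ln\<close> would return 0 and the exponential bound would fail.\<close>
    moreover have "0 < h * real k ^ CARD('d)" using h n by simp
    ultimately have "c > 0" by (cases c) auto
    with le have "exp (h * real k ^ CARD('d)) \<le> real c"
      by (simp add: ln_ge_iff)
    then show "\<omega> \<in> {\<omega>. exp (h * real k ^ CARD('d)) \<le> real (card {u \<in> patterns A k. ?W u \<subseteq> \<omega>})}"
      by (simp add: c_def legal_patterns_def)
  qed
  then have "measure_pmf.prob ?p {\<omega>. ereal h \<le> periodic_entropy (sft A n \<omega>)}
      \<le> measure_pmf.prob ?p {\<omega>. exp (h * real k ^ CARD('d)) \<le> real (card {u \<in> patterns A k. ?W u \<subseteq> \<omega>})}"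
    by (rule measure_pmf.finite_measure_mono) simp
  also have "\<dots> \<le> (\<Sum>u\<in>patterns A k. \<alpha> ^ card (?W u)) / exp (h * real k ^ CARD('d))"
    using A by (intro count_markov \<alpha> window_subset_patterns n) auto
  also have "\<dots> \<le> real (encodings CARD('d) n k) *
      (real (card A) ^ (k ^ CARD('d) - K) * max 1 (\<alpha> * card A) ^ K) / exp (h * real k ^ CARD('d))"
    unfolding K_def by (intro divide_right_mono first_moment_bound A \<alpha> n) simp
  finally show ?thesis .
qed

text \<open>With f cells in the frame there are |A|^f ways to fill it, so some filling is shared by
  a fraction of at least |A|^(-f) of \<open>Y\<close>. The subtracted term is the price of this
  pigeonhole step.\<close>

lemma periodic_entropy_ge_card:
  fixes \<omega> :: "(int ^ 'd::finite \<Rightarrow> 'a) set"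
  assumes A: "finite A" "A \<noteq> {}" and n: "n \<le> k" "k > 0" and Y: "Y \<subseteq> patterns A k" "Y \<noteq> {}"
    and sft: "\<And>u. u \<in> Y \<Longrightarrow> periodize k u \<in> sft A n \<omega>"
  shows "ereal ((ln (real (card Y)) - real (k ^ CARD('d) - (k - n) ^ CARD('d)) * ln (real (card A)))
      / real k ^ CARD('d)) \<le> periodic_entropy (sft A n \<omega>)"
proof -
  define Fr where "Fr = {s :: int ^ 'd. s \<in> cube k \<and> (\<exists>i. s $ i \<le> int n)}"
  define f where "f = (k ^ CARD('d) - (k - n) ^ CARD('d))"
  have cFr: "card Fr = f"
  proof -
    define I where "I = {s :: int ^ 'd. \<forall>i. int n + 1 \<le> s $ i \<and> s $ i \<le> int k}"
    have "card I = (k - n) ^ CARD('d)"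
      unfolding I_def int_box_card(2) using n by (simp add: nat_diff_distrib' flip: of_nat_diff)
    moreover have "I \<subseteq> cube k" by (auto simp: I_def cube_def intro: order_trans[of 1 "int n + 1"])
    moreover have "Fr = cube k - I"
      unfolding Fr_def I_def cube_def by (auto simp: not_le) (metis zless_add1_eq add1_zle_eq not_le)
    ultimately show ?thesis by (simp add: card_Diff_subset finite_subset f_def)
  qed
  have finFr: "finite Fr" by (simp add: Fr_def)
  have finY: "finite Y" using Y(1) A finite_subset finite_patterns by blast
  have "\<exists>y\<in>Fr \<rightarrow>\<^sub>E A. card ((\<lambda>u. restrict u Fr) -` {y} \<inter> Y) * card (Fr \<rightarrow>\<^sub>E A) \<ge> card Y"
  proof (rule pigeonhole_card)
    show "(\<lambda>u. restrict u Fr) \<in> Y \<rightarrow> Fr \<rightarrow>\<^sub>E A"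
      using Y(1) by (force simp: patterns_def Fr_def)
    show "(Fr \<rightarrow>\<^sub>E A) \<noteq> {}" using A by (simp add: PiE_eq_empty_iff)
  qed (use finFr finY A in \<open>auto intro: finite_PiE\<close>)
  then obtain y where y: "card ((\<lambda>u. restrict u Fr) -` {y} \<inter> Y) * card (Fr \<rightarrow>\<^sub>E A) \<ge> card Y" by blast
  define S where "S = (\<lambda>u. restrict u Fr) -` {y} \<inter> Y"
  have SY: "S \<subseteq> Y" by (simp add: S_def)
  have cS: "card Y \<le> card S * card A ^ f"
    using y finFr by (simp add: S_def card_PiE cFr)
  have cY: "card Y > 0" using Y(2) finY by (simp add: card_gt_0_iff)
  then have S0: "card S > 0" using cS by (cases "card S") auto
  have "real (card Y) \<le> real (card S) * real (card A) ^ f"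
    using cS by (metis of_nat_mono of_nat_mult of_nat_power)
  then have "ln (real (card Y)) \<le> ln (real (card S) * real (card A) ^ f)"
    using cY by (intro ln_mono) simp_all
  also have "\<dots> = ln (real (card S)) + real f * ln (real (card A))"
    using S0 A by (simp add: ln_mult ln_realpow card_gt_0_iff)
  finally have le: "ln (real (card Y)) - real f * ln (real (card A)) \<le> ln (real (card S))" by simp
  have "ereal (ln (real (card S)) / real k ^ CARD('d)) \<le> periodic_entropy (sft A n \<omega>)"
  proof (rule periodic_entropy_ge[OF A(1) n])
    show "S \<subseteq> patterns A k" using SY Y(1) by simp
    show "S \<noteq> {}" using S0 by auto
    show "periodize k u \<in> sft A n \<omega>" if "u \<in> S" for u using sft that SY by auto
    show "u s = v s" if "u \<in> S" "v \<in> S" "s \<in> cube k" "\<exists>i. s $ i \<le> int n" for u v s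
    proof -
      have "restrict u Fr s = restrict v Fr s" using that(1,2) by (auto simp: S_def)
      then show ?thesis using that(3,4) by (simp add: Fr_def)
    qed
  qed
  moreover have "ereal ((ln (real (card Y)) - real f * ln (real (card A))) / real k ^ CARD('d))
      \<le> ereal (ln (real (card S)) / real k ^ CARD('d))"
    using le by (simp add: divide_right_mono)
  ultimately show ?thesis unfolding f_def by (rule order_trans[rotated])
qed

text \<open>Low entropy means that at most half of the expected number of repeat-free patterns is
  allowed. In the Chebyshev quotient the powers of \<alpha> |A| cancel down to the exponent -n^d,
  the size of one shared window.\<close>

lemma entropy_lower_tail:
  fixes A :: "'a set" and \<alpha> h :: real
  assumes A: "finite A" "A \<noteq> {}" and \<alpha>: "0 < \<alpha>" "\<alpha> \<le> 1" "1 \<le> \<alpha> * card A" and n: "n > 0" "2 * n \<le> k"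
    and large: "2 * (k ^ CARD('d::finite) * k ^ CARD('d)) \<le> card A ^ (n ^ CARD('d))"
    and h: "h * real k ^ CARD('d) < ln (\<alpha> * card A) * real k ^ CARD('d) - ln 4
      - real (k ^ CARD('d) - (k - n) ^ CARD('d)) * ln (card A)"
  shows "measure_pmf.prob (random_patterns A n \<alpha> :: (int ^ 'd \<Rightarrow> 'a) set pmf)
      {\<omega>. periodic_entropy (sft A n \<omega>) \<le> ereal h}
    \<le> 8 * real (encodings CARD('d) n k) / (\<alpha> * card A) ^ (n ^ CARD('d))"
proof -
  let ?p = "random_patterns A n \<alpha> :: (int ^ 'd \<Rightarrow> 'a) set pmf"
  define \<U> where "\<U> = (repeat_free A n k :: (int ^ 'd \<Rightarrow> 'a) set)"
  define N where "N = k ^ CARD('d)"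
  define m where "m = real (card A)"
  define enc where "enc = real (encodings CARD('d) n k)"
  have k: "k > 0" "n \<le> k" using n by auto
  have m: "m > 0" using A by (simp add: m_def card_gt_0_iff)
  have Nk: "real N = real k ^ CARD('d)" by (simp add: N_def)
  have nN: "n ^ CARD('d) \<le> N" unfolding N_def using k by (intro power_mono) auto
  have "card A ^ N \<le> 2 * card \<U>"
    unfolding \<U>_def N_def by (rule card_repeat_free[OF A(1) n large])
  then have cU: "m ^ N \<le> 2 * real (card \<U>)"
    unfolding m_def by (metis of_nat_mono of_nat_mult of_nat_numeral of_nat_power)
  moreover have "m ^ N > 0" using m by simp
  ultimately have U0: "card \<U> > 0" by linarith
  then have Une: "\<U> \<noteq> {}" by auto
  have sub: "\<U> \<subseteq> patterns A k" by (auto simp: \<U>_def repeat_free_def)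
  have "{\<omega>. periodic_entropy (sft A n \<omega>) \<le> ereal h}
      \<subseteq> {\<omega>. real (card {u \<in> \<U>. torus_windows n k u \<subseteq> \<omega>}) \<le> real (card \<U>) * \<alpha> ^ N / 2}"
  proof (rule subsetI, rule ccontr)
    fix \<omega> :: "(int ^ 'd \<Rightarrow> 'a) set"
    assume \<omega>: "\<omega> \<in> {\<omega>. periodic_entropy (sft A n \<omega>) \<le> ereal h}"
    define Y where "Y = {u \<in> \<U>. torus_windows n k u \<subseteq> \<omega>}"
    assume "\<omega> \<notin> {\<omega>. real (card {u \<in> \<U>. torus_windows n k u \<subseteq> \<omega>}) \<le> real (card \<U>) * \<alpha> ^ N / 2}"
    then have "real (card \<U>) * \<alpha> ^ N / 2 < real (card Y)" by (simp add: Y_def)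
    moreover have "m ^ N * \<alpha> ^ N \<le> 2 * real (card \<U>) * \<alpha> ^ N"
      using cU \<alpha> by (intro mult_right_mono) auto
    \<comment> \<open>One factor 2 stems from \<open>\<U>\<close> being only known to contain half
      of all patterns, the other from the threshold at half the mean. Together they are the
      \<open>ln 4\<close> in the condition on \<open>h\<close>.\<close>
    ultimately have "m ^ N * \<alpha> ^ N / 4 < real (card Y)" by linarith
    then have Y: "(\<alpha> * m) ^ N / 4 < real (card Y)"
      by (simp add: power_mult_distrib mult.commute)
    have am: "(\<alpha> * m) ^ N > 0" using \<alpha> m by simp
    have "ln ((\<alpha> * m) ^ N / 4) \<le> ln (real (card Y))"
      using Y am by (intro ln_mono) auto
    moreover have "ln ((\<alpha> * m) ^ N / 4) = real N * ln (\<alpha> * m) - ln 4"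
      using am \<alpha> m by (simp add: ln_div ln_realpow)
    ultimately have lnY: "real N * ln (\<alpha> * m) - ln 4 \<le> ln (real (card Y))" by simp
    have "card Y > 0" using Y am by linarith
    then have "Y \<noteq> {}" by auto
    then have "ereal ((ln (real (card Y)) - real (k ^ CARD('d) - (k - n) ^ CARD('d)) * ln (real (card A)))
      / real k ^ CARD('d)) \<le> periodic_entropy (sft A n \<omega>)"
      using sub k by (intro periodic_entropy_ge_card A) (auto simp: Y_def periodize_in_sft_iff)
    also have "\<dots> \<le> ereal h" using \<omega> by simp
    finally have "ln (real (card Y)) - real (k ^ CARD('d) - (k - n) ^ CARD('d)) * ln (real (card A))
        \<le> h * real k ^ CARD('d)"
      using k by (simp add: pos_divide_le_eq)
    then show False using h lnY unfolding m_def Nk by (simp add: mult.commute)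
  qed
  then have "measure_pmf.prob ?p {\<omega>. periodic_entropy (sft A n \<omega>) \<le> ereal h}
      \<le> measure_pmf.prob ?p {\<omega>. real (card {u \<in> \<U>. torus_windows n k u \<subseteq> \<omega>}) \<le> real (card \<U>) * \<alpha> ^ N / 2}"
    by (rule measure_pmf.finite_measure_mono) simp
  also have "\<dots> \<le> 4 * (enc * (\<alpha> ^ N * (\<alpha> * m) ^ (N - n ^ CARD('d))))
      / (real (card \<U>) * (\<alpha> ^ N * \<alpha> ^ N))"
  proof (rule count_chebyshev[OF A(1) \<alpha>(1,2) _ Une])
    show "finite \<U>" using A by (simp add: \<U>_def)
    show "torus_windows n k u \<subseteq> patterns A n" if "u \<in> \<U>" for u
      using torus_windows_subset_patterns sub that k by blast
    show "card (torus_windows n k u) = N" if "u \<in> \<U>" for u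
      using card_torus_windows that unfolding \<U>_def N_def by blast
    show "(\<Sum>v | v \<in> \<U> \<and> torus_windows n k u \<inter> torus_windows n k v \<noteq> {}.
        \<alpha> ^ card (torus_windows n k u \<union> torus_windows n k v))
      \<le> enc * (\<alpha> ^ N * (\<alpha> * m) ^ (N - n ^ CARD('d)))" if "u \<in> \<U>" for u
      using overlapping_pairs_bound[OF A(1) \<alpha> n(1) k(2)] that
      unfolding \<U>_def N_def enc_def m_def by blast
  qed
  also have "\<dots> = 4 * enc * (\<alpha> * m) ^ (N - n ^ CARD('d)) / (real (card \<U>) * \<alpha> ^ N)"
    using \<alpha> by simp
  also have "\<dots> \<le> 4 * enc * (\<alpha> * m) ^ (N - n ^ CARD('d)) / (m ^ N / 2 * \<alpha> ^ N)"
    using cU U0 \<alpha> m by (intro divide_left_mono mult_right_mono mult_nonneg_nonneg mult_pos_pos) (auto simp: enc_def)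
  also have "\<dots> = 8 * enc * (\<alpha> * m) ^ (N - n ^ CARD('d)) / (\<alpha> * m) ^ N"
    by (simp add: power_mult_distrib mult.commute)
  also have "(\<alpha> * m) ^ N = (\<alpha> * m) ^ (N - n ^ CARD('d)) * (\<alpha> * m) ^ (n ^ CARD('d))"
    using nN by (simp flip: power_add)
  also have "8 * enc * (\<alpha> * m) ^ (N - n ^ CARD('d)) / ((\<alpha> * m) ^ (N - n ^ CARD('d)) * (\<alpha> * m) ^ (n ^ CARD('d)))
      = 8 * enc / (\<alpha> * m) ^ (n ^ CARD('d))"
    using \<alpha> m by simp
  finally show ?thesis unfolding enc_def m_def .
qed

section \<open>Asymptotics\<close>

text \<open>For \<open>k = C * n\<close> the base is polynomial in \<open>n\<close>, while the
  exponent is only of order n^(d-1) because \<open>k div n\<close> is the constant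
  \<open>C\<close>.\<close>

lemma encodings_subexponential:
  fixes C d :: nat and \<delta> :: real
  assumes d: "d > 0" and \<delta>: "\<delta> > 0"
  shows "\<forall>\<^sub>F n in sequentially. real (encodings d n (C * n)) \<le> exp (\<delta> * real n ^ d)"
proof -
  \<comment> \<open>\<open>c\<close> is chosen such that C n + 1 \<le> c n, and \<open>B\<close>
    such that 2 c (c n)^(d-1) = B n^(d-1).\<close>
  define c B D where "c = real C + 1" and "B = 2 * c ^ d" and "D = real d"
  have c: "c > 0" "c \<ge> 1" by (simp_all add: c_def)
  have "(\<lambda>n. B * (ln 2 + 2 * D * ln (c * real n)) / real n) \<longlonglongrightarrow> 0"
    using c(1) by real_asymp
  then have "\<forall>\<^sub>F n in sequentially. B * (ln 2 + 2 * D * ln (c * real n)) / real n < \<delta>"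
    using \<delta> by (rule order_tendstoD)
  then show ?thesis
    using eventually_gt_at_top[of 0]
  proof eventually_elim
    case (elim n)
    define t where "t = c * real n"
    define e where "e = 2 * ((C + 1) * (C * n + 1) ^ (d - 1))"
    have t: "t \<ge> 1" using elim c mult_mono[of 1 c 1 "real n"] by (simp add: t_def)
    have kt: "real (C * n + 1) \<le> t" using elim by (simp add: t_def c_def algebra_simps)
    have "C * n div n = C" using elim by simp
    then have "encodings d n (C * n) = ((C * n + 1) ^ d * (C * n + 1) ^ d + 1) ^ e"
      by (simp only: encodings_def e_def)
    then have "real (encodings d n (C * n)) = (real (C * n + 1) ^ d * real (C * n + 1) ^ d + 1) ^ e"
      by (simp only: of_nat_power of_nat_add of_nat_mult of_nat_1)
    also have "\<dots> \<le> (t ^ d * t ^ d + t ^ d * t ^ d) ^ e"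
      using kt t by (intro power_mono add_mono mult_mono) (auto simp flip: power_add)
    also have "t ^ d * t ^ d + t ^ d * t ^ d = 2 * t ^ (2 * d)"
      by (simp only: mult_2 power_add)
    also have "(2 * t ^ (2 * d)) ^ e = exp (real e * (ln 2 + 2 * D * ln t))"
    proof -
      have "ln (2 * t ^ (2 * d)) = ln 2 + 2 * D * ln t"
        using t by (simp add: ln_mult ln_realpow D_def)
      moreover have "(2 * t ^ (2 * d)) ^ e = exp (real e * ln (2 * t ^ (2 * d)))"
        using t by (simp add: exp_of_nat_mult)
      ultimately show ?thesis by simp
    qed
    also have "\<dots> \<le> exp (\<delta> * real n ^ d)"
    proof -
      have "real (C * n + 1) ^ (d - 1) \<le> t ^ (d - 1)"
        using kt by (intro power_mono) simp_all
      moreover have "real e = 2 * (c * real (C * n + 1) ^ (d - 1))"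
        unfolding e_def c_def by (simp only: of_nat_power of_nat_add of_nat_mult of_nat_1 of_nat_numeral)
      ultimately have "real e \<le> 2 * (c * t ^ (d - 1))"
        using c by (simp add: mult_left_mono)
      also have "\<dots> = B * real n ^ (d - 1)"
        using d by (cases d) (simp_all add: t_def B_def power_mult_distrib)
      finally have "real e * (ln 2 + 2 * D * ln t) \<le> B * real n ^ (d - 1) * (ln 2 + 2 * D * ln t)"
        using t by (intro mult_right_mono) (auto simp: D_def)
      also have "\<dots> = real n ^ (d - 1) * (B * (ln 2 + 2 * D * ln t))" by simp
      also have "\<dots> \<le> real n ^ (d - 1) * (\<delta> * real n)"
        using elim by (intro mult_left_mono) (auto simp: t_def pos_divide_less_eq)
      also have "\<dots> = \<delta> * real n ^ d"
        using d by (cases d) simp_all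
      finally show ?thesis by simp
    qed
    finally show ?case .
  qed
qed

text \<open>Bernoulli's inequality for (1 - 1/C)^d. The bound serves both the frame and the excess
  of letters over window positions.\<close>

lemma frame_fraction:
  fixes C d n :: nat
  assumes "C \<ge> 1"
  shows "real ((C * n) ^ d - (C * n - n) ^ d) \<le> real d / real C * real (C * n) ^ d"
proof -
  have "1 + real d * (- (1 / real C)) \<le> (1 + - (1 / real C)) ^ d"
    using assms by (intro Bernoulli_inequality) simp
  then have "(1 - real d / real C) * real (C * n) ^ d \<le> (1 - 1 / real C) ^ d * real (C * n) ^ d"
    by (intro mult_right_mono) simp_all
  also have "\<dots> = ((1 - 1 / real C) * real (C * n)) ^ d"
    by (simp only: power_mult_distrib)
  also have "(1 - 1 / real C) * real (C * n) = real (C * n - n)"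
    using assms by (simp add: field_simps of_nat_diff)
  finally have "real (C * n) ^ d - real (C * n - n) ^ d \<le> real d / real C * real (C * n) ^ d"
    by (simp add: algebra_simps)
  then show ?thesis
    by (simp add: of_nat_diff power_mono)
qed

text \<open>\<open>C \<ge> 2\<close> provides \<open>2 * n \<le> C * n\<close> for the counting on
  the torus.\<close>

lemma large_multiple:
  fixes a \<epsilon> :: real
  assumes "\<epsilon> > 0"
  obtains C :: nat where "C \<ge> 2" "a / real C \<le> \<epsilon>"
proof -
  obtain C0 :: nat where C0: "a / \<epsilon> \<le> real C0" using real_arch_simple by blast
  have "a \<le> \<epsilon> * real (C0 + 2)"
    using C0 assms by (simp add: pos_divide_le_eq algebra_simps)
  then have "a / real (C0 + 2) \<le> \<epsilon>" by (simp add: pos_divide_le_eq)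
  then show thesis by (intro that[of "C0 + 2"]) auto
qed

lemma eventually_const_le_power:
  fixes r c :: real
  assumes "d > 0" "r > 0"
  shows "\<forall>\<^sub>F n in sequentially. c \<le> r * real n ^ d"
proof -
  have "filterlim (\<lambda>n. r * real n ^ d) at_top sequentially"
    using assms by (intro filterlim_tendsto_pos_mult_at_top[OF tendsto_const]
        filterlim_pow_at_top filterlim_real_sequentially) auto
  then show ?thesis by (simp add: filterlim_at_top)
qed

lemma exp_log_plus: "0 \<le> x \<Longrightarrow> max 1 x = exp (log_plus x)"
  by (cases "x = 0"; cases "x \<ge> 1") (auto simp: log_plus_def max_def not_le ln_ge_zero_iff)

lemma upper_deviation:
  fixes A :: "'a set" and \<alpha> \<epsilon> :: real
  assumes A: "finite A" and \<alpha>: "0 \<le> \<alpha>" "\<alpha> \<le> 1" and \<epsilon>: "\<epsilon> > 0"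
  shows "\<exists>\<rho>>0. \<forall>\<^sub>F n in sequentially.
    measure_pmf.prob (random_patterns A n \<alpha> :: (int ^ 'd::finite \<Rightarrow> 'a) set pmf)
      {\<omega>. ereal (log_plus (\<alpha> * card A) + \<epsilon>) \<le> periodic_entropy (sft A n \<omega>)}
    \<le> exp (- \<rho> * real n ^ CARD('d))"
proof -
  define d where "d = CARD('d)"
  define m where "m = real (card A)"
  define L where "L = log_plus (\<alpha> * m)"
  have d: "d > 0" by (simp add: d_def)
  have L0: "L \<ge> 0" by (simp add: L_def log_plus_def)
  show ?thesis
  proof (cases "A = {}")
    case True
    \<comment> \<open>Over the empty alphabet a nonempty box carries no pattern, so the bound on the
      entropy is \<open>ln 0 = 0\<close> and the event is impossible.\<close>
    have none: "\<not> ereal (L + \<epsilon>) \<le> periodic_entropy (sft A n \<omega>)" if "n > 0" for n and \<omega> :: "(int ^ 'd \<Rightarrow> 'a) set"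
    proof -
      have "legal_patterns A n n \<omega> \<subseteq> {}"
        using True cube_nonempty[OF that, where 'a = 'd] unfolding legal_patterns_def patterns_def by auto
      then have "card (legal_patterns A n n \<omega>) = 0" by simp
      then have "periodic_entropy (sft A n \<omega>) \<le> ereal 0"
        using periodic_entropy_le[OF A that order_refl, of \<omega>] by simp
      also have "\<dots> < ereal (L + \<epsilon>)" using L0 \<epsilon> by simp
      finally show ?thesis by simp
    qed
    have "\<forall>\<^sub>F n in sequentially.
      measure_pmf.prob (random_patterns A n \<alpha> :: (int ^ 'd \<Rightarrow> 'a) set pmf)
        {\<omega>. ereal (L + \<epsilon>) \<le> periodic_entropy (sft A n \<omega>)} \<le> exp (- 1 * real n ^ CARD('d))"
      using eventually_gt_at_top[of 0] by eventually_elim (simp only: none Collect_const if_False measure_empty exp_ge_zero)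
    then show ?thesis
      unfolding L_def m_def by (intro exI[of _ 1]) simp
  next
    case False
    then have m: "m \<ge> 1" using A by (simp add: m_def Suc_leI card_gt_0_iff)
    \<comment> \<open>A quarter of \<epsilon> pays for the boundary letters through the choice of
      \<open>C\<close>, another quarter for the encodings. As the box has at least n^d cells, one
      half remains as the rate.\<close>
    obtain C :: nat where C: "C \<ge> 2" "real d * ln m / real C \<le> \<epsilon> / 4"
      using large_multiple[of "\<epsilon> / 4" "real d * ln m"] \<epsilon> by auto
    have "\<forall>\<^sub>F n in sequentially. real (encodings d n (C * n)) \<le> exp (\<epsilon> / 4 * real n ^ d)"
      using d \<epsilon> by (intro encodings_subexponential) auto
    then have "\<forall>\<^sub>F n in sequentially.
      measure_pmf.prob (random_patterns A n \<alpha> :: (int ^ 'd \<Rightarrow> 'a) set pmf)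
        {\<omega>. ereal (L + \<epsilon>) \<le> periodic_entropy (sft A n \<omega>)} \<le> exp (- (\<epsilon> / 2) * real n ^ d)"
      using eventually_gt_at_top[of 0]
    proof eventually_elim
      case (elim n)
      define k where "k = C * n"
      define N where "N = real k ^ d"
      define K where "K = (k - n + 1) ^ d"
      have nk: "n \<le> k" using C by (simp add: k_def)
      have nN: "real n ^ d \<le> N" unfolding N_def using nk by (intro power_mono) auto
      have KN: "real K \<le> N"
        using nk elim unfolding K_def N_def by (auto intro!: power_mono simp flip: of_nat_power)
      have "(k - n) ^ d \<le> K" unfolding K_def by (intro power_mono) auto
      then have "real (k ^ d - K) \<le> real (k ^ d - (k - n) ^ d)" by simp
      also have "\<dots> \<le> real d / real C * N"
        unfolding k_def N_def using C by (intro frame_fraction) auto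
      finally have "real (k ^ d - K) * ln m \<le> real d / real C * N * ln m"
        using m by (intro mult_right_mono) auto
      also have "\<dots> = real d * ln m / real C * N" by simp
      also have "\<dots> \<le> \<epsilon> / 4 * N"
        using C by (intro mult_right_mono) (auto simp: N_def)
      finally have frame: "m ^ (k ^ d - K) \<le> exp (\<epsilon> / 4 * N)"
        using m by (simp add: exp_of_nat_mult flip: powr_realpow) (simp add: powr_def)
      have mx: "max 1 (\<alpha> * m) ^ K \<le> exp (L * N)"
      proof -
        have "max 1 (\<alpha> * m) ^ K = exp (real K * L)"
          using \<alpha> m by (simp add: exp_log_plus L_def exp_of_nat_mult)
        also have "\<dots> \<le> exp (L * N)"
          using KN L0 by (simp add: mult.commute mult_left_mono)
        finally show ?thesis .
      qed
      have "measure_pmf.prob (random_patterns A n \<alpha> :: (int ^ 'd \<Rightarrow> 'a) set pmf)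
          {\<omega>. ereal (L + \<epsilon>) \<le> periodic_entropy (sft A n \<omega>)}
        \<le> real (encodings d n k) * (m ^ (k ^ d - K) * max 1 (\<alpha> * m) ^ K) / exp ((L + \<epsilon>) * N)"
        unfolding d_def m_def K_def N_def
        using A False \<alpha> elim nk L0 \<epsilon> by (intro entropy_upper_tail) auto
      also have "\<dots> \<le> exp (\<epsilon> / 4 * real n ^ d) * (exp (\<epsilon> / 4 * N) * exp (L * N)) / exp ((L + \<epsilon>) * N)"
        using elim frame mx m by (intro divide_right_mono mult_mono) (auto simp: k_def)
      also have "\<dots> = exp (\<epsilon> / 4 * real n ^ d - 3 * \<epsilon> / 4 * N)"
        by (simp add: algebra_simps flip: exp_add exp_diff)
      also have "\<dots> \<le> exp (- (\<epsilon> / 2) * real n ^ d)"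
        using mult_left_mono[OF nN, of "3 * \<epsilon> / 4"] \<epsilon> by (simp add: algebra_simps)
      finally show ?case .
    qed
    then show ?thesis
      using \<epsilon> unfolding L_def m_def d_def by (intro exI[of _ "\<epsilon> / 2"]) auto
  qed
qed

lemma lower_deviation:
  fixes A :: "'a set" and \<alpha> \<epsilon> :: real
  assumes A: "finite A" and \<alpha>: "0 \<le> \<alpha>" "\<alpha> \<le> 1" and \<epsilon>: "\<epsilon> > 0"
  shows "\<exists>\<rho>>0. \<forall>\<^sub>F n in sequentially.
    measure_pmf.prob (random_patterns A n \<alpha> :: (int ^ 'd::finite \<Rightarrow> 'a) set pmf)
      {\<omega>. periodic_entropy (sft A n \<omega>) \<le> ereal (log_plus (\<alpha> * card A) - \<epsilon>)}
    \<le> exp (- \<rho> * real n ^ CARD('d))"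
proof -
  define d where "d = CARD('d)"
  define m where "m = real (card A)"
  define l where "l = ln (\<alpha> * m)"
  have d: "d > 0" by (simp add: d_def)
  show ?thesis
  proof (cases "\<alpha> * m \<le> 1")
    case True
    then have "log_plus (\<alpha> * m) = 0"
      using \<alpha> by (cases "\<alpha> * m = 0") (auto simp: log_plus_def m_def)
    moreover have "\<not> periodic_entropy (sft A n \<omega>) \<le> ereal (0 - \<epsilon>)"
      for n and \<omega> :: "(int ^ 'd \<Rightarrow> 'a) set"
    proof -
      have "ereal (0 - \<epsilon>) < 0" using \<epsilon> by simp
      also have "0 \<le> periodic_entropy (sft A n \<omega>)" by (rule periodic_entropy_nonneg)
      finally show ?thesis by simp
    qed
    ultimately show ?thesis unfolding m_def by (intro exI[of _ 1]) simp
  next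
    case False
    then have l: "l > 0" "log_plus (\<alpha> * m) = l" by (simp_all add: l_def log_plus_def)
    have \<alpha>0: "\<alpha> > 0" using False \<alpha> by (cases "\<alpha> = 0") auto
    have "\<alpha> * m \<le> m" using \<alpha> mult_right_mono[of \<alpha> 1 m] by (simp add: m_def)
    then have "m > 1" using False by simp
    then have m: "m \<ge> 2" by (simp add: m_def)
    then have A_ne: "A \<noteq> {}" by (auto simp: m_def)
    obtain C :: nat where C: "C \<ge> 2" "real d * ln m / real C \<le> \<epsilon> / 4"
      using large_multiple[of "\<epsilon> / 4" "real d * ln m"] \<epsilon> by auto
    have ev1: "\<forall>\<^sub>F n in sequentially. real (encodings d n (C * n)) \<le> exp (l / 4 * real n ^ d)"
      using d l by (intro encodings_subexponential) auto
    have ev2: "\<forall>\<^sub>F n in sequentially. ln 8 \<le> l / 4 * real n ^ d"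
      "\<forall>\<^sub>F n in sequentially. 2 * ln 4 \<le> \<epsilon> * real n ^ d"
      using d l \<epsilon> by (auto intro!: eventually_const_le_power)
    \<comment> \<open>This supplies the hypothesis \<open>large\<close>: |A|^(n^d) is at least 2^n,
      which outgrows the number of pairs of torus positions, a polynomial in
      \<open>n\<close>.\<close>
    have ev3: "\<forall>\<^sub>F n in sequentially. 2 * (real C * real n) ^ (2 * d) \<le> 2 ^ n"
    proof -
      have "(\<lambda>n. (ln 2 * real n) ^ (2 * d) / exp (ln 2 * real n)) \<longlonglongrightarrow> 0"
        by (rule filterlim_compose[OF tendsto_power_div_exp_0])
          (intro filterlim_tendsto_pos_mult_at_top[OF tendsto_const] filterlim_real_sequentially, simp)
      then have "(\<lambda>n. 2 * (real C / ln 2) ^ (2 * d) * ((ln 2 * real n) ^ (2 * d) / exp (ln 2 * real n)))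
          \<longlonglongrightarrow> 2 * (real C / ln 2) ^ (2 * d) * 0"
        by (rule tendsto_mult[OF tendsto_const])
      moreover have "2 * (real C / ln 2) ^ (2 * d) * ((ln 2 * real n) ^ (2 * d) / exp (ln 2 * real n))
          = 2 * (real C * real n) ^ (2 * d) / 2 ^ n" for n
        by (simp add: power_mult_distrib power_divide mult.commute[of "ln 2" "real n"] exp_of_nat_mult)
      ultimately have "(\<lambda>n. 2 * (real C * real n) ^ (2 * d) / 2 ^ n) \<longlonglongrightarrow> 0"
        by simp
      then have "\<forall>\<^sub>F n in sequentially. 2 * (real C * real n) ^ (2 * d) / 2 ^ n < 1"
        by (rule order_tendstoD) simp
      then show ?thesis
        by eventually_elim (simp add: pos_divide_less_eq)
    qed
    have "\<forall>\<^sub>F n in sequentially.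
      measure_pmf.prob (random_patterns A n \<alpha> :: (int ^ 'd \<Rightarrow> 'a) set pmf)
        {\<omega>. periodic_entropy (sft A n \<omega>) \<le> ereal (l - \<epsilon>)} \<le> exp (- (l / 2) * real n ^ d)"
      using ev1 ev2 ev3 eventually_gt_at_top[of 0]
    proof eventually_elim
      case (elim n)
      define k where "k = C * n"
      define N where "N = real k ^ d"
      have nk: "2 * n \<le> k" using C by (simp add: k_def)
      have nN: "real n ^ d \<le> N" unfolding N_def using nk by (intro power_mono) auto
      have N0: "N > 0" using nk elim by (simp add: N_def)
      have large: "2 * (k ^ d * k ^ d) \<le> card A ^ (n ^ d)"
      proof -
        have "real k ^ d * real k ^ d = real k ^ (2 * d)"
          by (simp only: mult_2 power_add)
        then have "real (2 * (k ^ d * k ^ d)) = 2 * (real C * real n) ^ (2 * d)"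
          by (simp add: k_def)
        also have "\<dots> \<le> 2 ^ n" by (rule elim(4))
        also have "\<dots> \<le> m ^ n" using m by (intro power_mono) auto
        also have "\<dots> \<le> m ^ (n ^ d)"
        proof (rule power_increasing)
          show "n \<le> n ^ d" using elim(5) d by (intro self_le_power) auto
        qed (use m in simp)
        also have "\<dots> = real (card A ^ (n ^ d))" by (simp add: m_def)
        finally show ?thesis by (simp only: of_nat_le_iff)
      qed
      have "real (k ^ d - (k - n) ^ d) \<le> real d / real C * N"
        unfolding k_def N_def using C by (intro frame_fraction) auto
      then have "real (k ^ d - (k - n) ^ d) * ln m \<le> real d / real C * N * ln m"
        using m by (intro mult_right_mono) auto
      also have "\<dots> = real d * ln m / real C * N" by simp
      also have "\<dots> \<le> \<epsilon> / 4 * N"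
        using C N0 by (intro mult_right_mono) auto
      finally have frame: "real (k ^ d - (k - n) ^ d) * ln m \<le> \<epsilon> / 4 * N" .
      have "2 * ln 4 \<le> \<epsilon> * N"
        using elim mult_left_mono[OF nN, of \<epsilon>] \<epsilon> by linarith
      \<comment> \<open>\<open>ln 4\<close> takes at most half of \<epsilon> N and the frame a
        quarter; the remaining quarter makes the inequality strict.\<close>
      then have h: "(l - \<epsilon>) * N < l * N - ln 4 - real (k ^ d - (k - n) ^ d) * ln m"
        using frame mult_pos_pos[OF \<epsilon> N0] by (simp add: algebra_simps)
      have "measure_pmf.prob (random_patterns A n \<alpha> :: (int ^ 'd \<Rightarrow> 'a) set pmf)
          {\<omega>. periodic_entropy (sft A n \<omega>) \<le> ereal (l - \<epsilon>)}
        \<le> 8 * real (encodings d n k) / (\<alpha> * m) ^ (n ^ d)"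
        using large h False unfolding d_def m_def N_def l_def
        by (intro entropy_lower_tail A A_ne \<alpha>0 \<alpha>(2) nk elim) auto
      also have "(\<alpha> * m) ^ (n ^ d) = exp (l * real n ^ d)"
      proof -
        have "\<alpha> * m = exp l" using False by (simp add: l_def)
        then show ?thesis using exp_of_nat_mult[of "n ^ d" l] by (simp add: mult.commute)
      qed
      \<comment> \<open>The constant 8 and the encodings take a quarter of the exponent l n^d each,
        which leaves the rate l/2.\<close>
      also have "8 * real (encodings d n k) / exp (l * real n ^ d)
          \<le> exp (l / 4 * real n ^ d) * exp (l / 4 * real n ^ d) / exp (l * real n ^ d)"
      proof -
        have "exp (ln 8) \<le> exp (l / 4 * real n ^ d)"
          using elim by (simp only: exp_le_cancel_iff)
        then have "8 \<le> exp (l / 4 * real n ^ d)" by simp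
        then show ?thesis
          using elim by (intro divide_right_mono mult_mono) (auto simp: k_def)
      qed
      also have "\<dots> = exp (l / 4 * real n ^ d + l / 4 * real n ^ d - l * real n ^ d)"
        by (simp only: exp_add exp_diff)
      also have "l / 4 * real n ^ d + l / 4 * real n ^ d - l * real n ^ d = - (l / 2) * real n ^ d"
        by (simp add: field_simps)
      finally show ?case .
    qed
    then show ?thesis
      using l unfolding m_def d_def by (intro exI[of _ "l / 2"]) auto
  qed
qed

theorem theorem1p4:
  fixes A :: "'a set" and \<alpha> \<epsilon> :: real
  assumes "finite A" and "0 \<le> \<alpha>" and "\<alpha> \<le> 1" and "\<epsilon> > 0"
  shows "\<exists>\<rho>::real. \<rho> > 0 \<and> (\<exists>n0::nat. \<forall>n\<ge>n0.
    measure_pmf.prob (random_patterns A n \<alpha> :: (int ^ 'd::finite \<Rightarrow> 'a) set pmf)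
      {\<omega> \<in> Pow (patterns A n).
         \<bar>periodic_entropy (sft A n \<omega>) - ereal (log_plus (\<alpha> * real (card A)))\<bar> \<ge> ereal \<epsilon>}
    \<le> exp (- \<rho> * real n ^ CARD('d)))"
proof -
  define L where "L = log_plus (\<alpha> * real (card A))"
  let ?P = "\<lambda>n. measure_pmf.prob (random_patterns A n \<alpha> :: (int ^ 'd \<Rightarrow> 'a) set pmf)"
  let ?up = "\<lambda>n. {\<omega> :: (int ^ 'd \<Rightarrow> 'a) set. ereal (L + \<epsilon>) \<le> periodic_entropy (sft A n \<omega>)}"
  let ?lo = "\<lambda>n. {\<omega> :: (int ^ 'd \<Rightarrow> 'a) set. periodic_entropy (sft A n \<omega>) \<le> ereal (L - \<epsilon>)}"
  let ?ev = "\<lambda>n. {\<omega> \<in> Pow (patterns A n :: (int ^ 'd \<Rightarrow> 'a) set).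
    \<bar>periodic_entropy (sft A n \<omega>) - ereal L\<bar> \<ge> ereal \<epsilon>}"
  obtain r1 where r1: "r1 > 0"
    "\<forall>\<^sub>F n in sequentially. ?P n (?up n) \<le> exp (- r1 * real n ^ CARD('d))"
    using upper_deviation[OF assms] unfolding L_def by blast
  obtain r2 where r2: "r2 > 0"
    "\<forall>\<^sub>F n in sequentially. ?P n (?lo n) \<le> exp (- r2 * real n ^ CARD('d))"
    using lower_deviation[OF assms] unfolding L_def by blast
  \<comment> \<open>Halving the rate absorbs the factor 2 from the sum of the two tails.\<close>
  define r where "r = min r1 r2 / 2"
  have r: "r > 0" using r1 r2 by (simp add: r_def)
  have "\<forall>\<^sub>F n in sequentially. ln 2 \<le> r * real n ^ CARD('d)"
    using r by (intro eventually_const_le_power) auto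
  then have "\<forall>\<^sub>F n in sequentially. ?P n (?ev n) \<le> exp (- r * real n ^ CARD('d))"
    using r1(2) r2(2)
  proof eventually_elim
    case (elim n)
    define N where "N = real n ^ CARD('d)"
    have "?ev n \<subseteq> ?up n \<union> ?lo n"
    proof
      fix \<omega> assume "\<omega> \<in> ?ev n"
      then have "\<bar>periodic_entropy (sft A n \<omega>) - ereal L\<bar> \<ge> ereal \<epsilon>" by simp
      then show "\<omega> \<in> ?up n \<union> ?lo n"
        by (cases "periodic_entropy (sft A n \<omega>)") (auto simp: abs_if split: if_splits)
    qed
    then have "?P n (?ev n) \<le> ?P n (?up n \<union> ?lo n)"
      by (rule measure_pmf.finite_measure_mono) simp
    also have "\<dots> \<le> ?P n (?up n) + ?P n (?lo n)"
      by (rule measure_Un_le) simp_all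
    also have "\<dots> \<le> exp (- r1 * N) + exp (- r2 * N)"
      using elim unfolding N_def by (intro add_mono) auto
    also have "\<dots> \<le> exp (- (2 * r) * N) + exp (- (2 * r) * N)"
      unfolding r_def by (intro add_mono) (auto simp: N_def intro!: mult_right_mono)
    also have "\<dots> = exp (ln 2 - 2 * r * N)" by (simp add: exp_diff exp_minus field_simps)
    also have "\<dots> \<le> exp (- r * N)" using elim by (simp add: N_def)
    finally show ?case by (simp add: N_def)
  qed
  then show ?thesis
    using r unfolding eventually_sequentially L_def by blast
qed

end
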